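(* Let $3\le n_1\le n_2\le n_3$, where each $n_k$ is an integer or $\infty$. Let $a=4\cos^2(\pi/n_1)$, $b=4\cos^2(\pi/n_2)$ and $c=4\cos^2(\pi/n_3)$ (with $\pi/\infty=0$). Then $(n_1,n_2,n_3)$ has type A if and only if $F(a,b,c)>0$, where $$\begin{aligned}F(a,b,c)={}&-176+96a-8a^2+4a^3+a^4+96b+8ab-36a^2b+2a^3b-2a^4b-8b^2\\&-36ab^2+23a^2b^2+a^4b^2+4b^3+2ab^3-2a^3b^3+b^4-2ab^4+a^2b^4+120c-64ac\\&+10a^2c+2a^3c-64bc+50abc-14a^2bc-2a^3bc+10b^2c-14ab^2c+8a^2b^2c\\&+2b^3c-2ab^3c-35c^2+14ac^2+a^2c^2+14bc^2-10abc^2+b^2c^2+4c^3.\end{aligned}$$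
   Context: Complex hyperbolic plane. $\mathbb{C}^{2,1}$ is $\mathbb{C}^3$ with the Hermitian form $\langle u,v\rangle=u_1\overline{v_1}+u_2\overline{v_2}-u_3\overline{v_3}$. The complex hyperbolic plane $\mathbb{H}^2_{\mathbb{C}}$ is the projectivization of $\{v:\langle v,v\rangle<0\}$, with ideal boundary the projectivization of $\{v\neq0:\langle v,v\rangle=0\}$. $PU(2,1)$, the projectivization of $SU(2,1)$, acts on it by holomorphic isometries. An element of $PU(2,1)$ is elliptic if it fixes at least one point of $\mathbb{H}^2_{\mathbb{C}}$. A vector $\mathbf{c}$ with $\langle\mathbf{c},\mathbf{c}\rangle>0$ (a polar vector) determines the complex geodesic (complex slice) orthogonal to it, and the complex reflection $I_{\mathbf{c}}(\mathbf{v})=-\mathbf{v}+\frac{2\langle\mathbf{v},\mathbf{c}\rangle}{\langle\mathbf{c},\mathbf{c}\rangle}\mathbf{c}$, whose fixed point set is that complex geodesic. Two complex geodesics with polar vectors $c,c'$ normalized by $\langle c,c\rangle=\langle c',c'\rangle=1$ meet at angle $\alpha$ iff $|\langle c,c'\rangle|=\cos\alpha$ (angle $0$: they meet at a point of the ideal boundary). Triangle groups. Indices are taken mod 3. An $(n_1,n_2,n_3)$-triangle is a triple of complex geodesics $C_1,C_2,C_3$ such that $C_{k-1}$ and $C_{k+1}$ meet at angle $\pi/n_k$ for $k=1,2,3$. Let $I_k$ be the complex reflection in $C_k$; the associated $(n_1,n_2,n_3)$-triangle group is the subgroup of $PU(2,1)$ generated by $I_1,I_2,I_3$. With polar vectors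 $c_k$ of $C_k$, let $\theta=\arg\left(\prod_{k=1}^3\langle c_{k-1},c_{k+1}\rangle/\prod_{k=1}^3\langle c_k,c_k\rangle\right)$, $t=\cos\theta$, $r_k=\cos(\pi/n_k)$, and $t_u=\min\left\{\frac{r_1^2+r_2^2+r_3^2-1}{2r_1r_2r_3},1\right\}$. For fixed $(n_1,n_2,n_3)$ the deformation space of $(n_1,n_2,n_3)$-triangle groups is parametrized by $t\in[-1,t_u)$. Types. Let $W_A=I_1I_3I_2I_3$ and $W_B=I_1I_2I_3$. The triple $(n_1,n_2,n_3)$ has type A if, as the parameter $t$ increases from $-1$ through the deformation space, $W_A$ becomes elliptic before $W_B$ does; otherwise it has type B. *)

theory Defs
  imports "HOL-Analysis.Analysis" "HOL-Library.Extended_Nat"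
begin

text \<open>Indices mod 3 are the elements of the finite type \<^typ>\<open>3\<close>: its arithmetic is modulo 3
  and \<open>3 = 0\<close>, so \<open>k - 1\<close> and \<open>k + 1\<close> wrap around.\<close>

definition herm :: "complex^3 \<Rightarrow> complex^3 \<Rightarrow> complex" where
  "herm u v = u$1 * cnj (v$1) + u$2 * cnj (v$2) - u$3 * cnj (v$3)"

text \<open>The projective class of a nonzero vector is the line through it with the origin removed.
  Signs of \<open>herm v v\<close> are read off its real part, since it is always real.\<close>

definition proj_class :: "complex^3 \<Rightarrow> (complex^3) set" where
  "proj_class v = {z *s v | z. z \<noteq> 0}"

definition complex_hyperbolic_plane :: "(complex^3) set set" where
  "complex_hyperbolic_plane = proj_class ` {v. Re (herm v v) < 0}"

text \<open>Elements of \<open>PU(2,1)\<close> are represented by linear lifts \<open>g\<close>, which act on projective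
  classes by taking images.\<close>

definition elliptic :: "(complex^3 \<Rightarrow> complex^3) \<Rightarrow> bool" where
  "elliptic g \<longleftrightarrow> (\<exists>p\<in>complex_hyperbolic_plane. g ` p = p)"

definition complex_geodesic :: "complex^3 \<Rightarrow> (complex^3) set set" where
  "complex_geodesic c = {p \<in> complex_hyperbolic_plane. \<forall>v\<in>p. herm v c = 0}"

definition polar_vector :: "complex^3 \<Rightarrow> (complex^3) set set \<Rightarrow> bool" where
  "polar_vector c C \<longleftrightarrow> Re (herm c c) > 0 \<and> C = complex_geodesic c"

definition complex_reflection :: "complex^3 \<Rightarrow> complex^3 \<Rightarrow> complex^3" where
  "complex_reflection c v = - v + (2 * herm v c / herm c c) *s c"

text \<open>For \<open>\<alpha> = 0\<close> the condition also holds if \<open>C = C'\<close>. This is harmless below: a triangle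
  with two equal sides has parameter \<open>t = 1\<close>, outside the deformation space.\<close>

definition meet_at_angle ::
    "(complex^3) set set \<Rightarrow> (complex^3) set set \<Rightarrow> real \<Rightarrow> bool" where
  "meet_at_angle C C' \<alpha> \<longleftrightarrow>
     (\<exists>c c'. polar_vector c C \<and> polar_vector c' C' \<and> herm c c = 1 \<and> herm c' c' = 1
        \<and> cmod (herm c c') = cos \<alpha>)"

definition pi_over :: "enat \<Rightarrow> real" where
  "pi_over n = (case n of enat m \<Rightarrow> pi / real m | \<infinity> \<Rightarrow> 0)"

definition is_triangle :: "(3 \<Rightarrow> enat) \<Rightarrow> (3 \<Rightarrow> (complex^3) set set) \<Rightarrow> bool" where
  "is_triangle n C \<longleftrightarrow> (\<forall>k. meet_at_angle (C (k - 1)) (C (k + 1)) (pi_over (n k)))"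

definition angular_invariant :: "(3 \<Rightarrow> complex^3) \<Rightarrow> real" where
  "angular_invariant c =
     Arg ((\<Prod>k\<in>UNIV. herm (c (k - 1)) (c (k + 1))) / (\<Prod>k\<in>UNIV. herm (c k) (c k)))"

definition t_upper :: "(3 \<Rightarrow> enat) \<Rightarrow> real" where
  "t_upper n = (let r = (\<lambda>k. cos (pi_over (n k)))
     in min (((r 1)\<^sup>2 + (r 2)\<^sup>2 + (r 3)\<^sup>2 - 1) / (2 * r 1 * r 2 * r 3)) 1)"

definition deformation_space :: "(3 \<Rightarrow> enat) \<Rightarrow> real set" where
  "deformation_space n = {-1..<t_upper n}"

definition word_A :: "(3 \<Rightarrow> complex^3) \<Rightarrow> complex^3 \<Rightarrow> complex^3" where
  "word_A c = complex_reflection (c 1) \<circ> complex_reflection (c 3)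
     \<circ> complex_reflection (c 2) \<circ> complex_reflection (c 3)"

definition word_B :: "(3 \<Rightarrow> complex^3) \<Rightarrow> complex^3 \<Rightarrow> complex^3" where
  "word_B c = complex_reflection (c 1) \<circ> complex_reflection (c 2) \<circ> complex_reflection (c 3)"

text \<open>The word \<open>W\<close> is elliptic in the triangle group with parameter \<open>t\<close>. For \<open>t\<close> in the
  deformation space such a triangle exists and is unique up to holomorphic and antiholomorphic
  isometries, so the choice of triangle and of polar vectors is immaterial.\<close>

definition elliptic_at ::
    "(3 \<Rightarrow> enat) \<Rightarrow> ((3 \<Rightarrow> complex^3) \<Rightarrow> complex^3 \<Rightarrow> complex^3) \<Rightarrow> real \<Rightarrow> bool" where
  "elliptic_at n W t \<longleftrightarrow>
     (\<exists>C c. is_triangle n C \<and> (\<forall>k. polar_vector (c k) (C k))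
        \<and> cos (angular_invariant c) = t \<and> elliptic (W c))"

text \<open>\<open>W_A\<close> becomes elliptic before \<open>W_B\<close>: at some parameter \<open>W_A\<close> is elliptic although
  \<open>W_B\<close> has not been elliptic up to and including that parameter. In particular \<open>W_B\<close> may
  never become elliptic, whereas \<open>W_A\<close> has to.\<close>

definition type_A :: "(3 \<Rightarrow> enat) \<Rightarrow> bool" where
  "type_A n \<longleftrightarrow>
     (\<exists>t\<in>deformation_space n. elliptic_at n word_A t
        \<and> (\<forall>s\<in>deformation_space n. s \<le> t \<longrightarrow> \<not> elliptic_at n word_B s))"

definition F_poly :: "real \<Rightarrow> real \<Rightarrow> real \<Rightarrow> real" where
  "F_poly a b c =
     -176+96*a-8*a^2+4*a^3+a^4+96*b+8*a*b-36*a^2*b+2*a^3*b-2*a^4*b-8*b^2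
     -36*a*b^2+23*a^2*b^2+a^4*b^2+4*b^3+2*a*b^3-2*a^3*b^3+b^4-2*a*b^4+a^2*b^4+120*c-64*a*c
     +10*a^2*c+2*a^3*c-64*b*c+50*a*b*c-14*a^2*b*c-2*a^3*b*c+10*b^2*c-14*a*b^2*c+8*a^2*b^2*c
     +2*b^3*c-2*a*b^3*c-35*c^2+14*a*c^2+a^2*c^2+14*b*c^2-10*a*b*c^2+b^2*c^2+4*c^3"

end

theory Submission
  imports Defs "HOL-Computational_Algebra.Fundamental_Theorem_Algebra"
begin

text \<open>
  After normalizing the polar vectors the triangle is encoded by its Gram matrix, whose negative
  determinant expresses that \<open>t\<close> lies in the deformation space. \<open>W_A\<close> is the product of the
  reflections in \<open>c\<^sub>1\<close> and \<open>I\<^sub>3 c\<^sub>2\<close>, hence elliptic exactly if \<open>|\<langle>c\<^sub>1, I\<^sub>3 c\<^sub>2\<rangle>| < 1\<close>, which is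
  \<open>x > (a b + c - 4) / 2\<close> for \<open>x = 8 r\<^sub>1 r\<^sub>2 r\<^sub>3 t\<close>. The characteristic polynomial of \<open>W_B\<close> is
  \<open>X\<^sup>3 - \<tau> X\<^sup>2 + \<tau>' X - 1\<close> with \<open>\<tau>'\<close> the conjugate of the trace \<open>\<tau>\<close>; its discriminant is Goldman's
  function of \<open>\<tau>\<close>. If it is negative, \<open>W_B\<close> is elliptic, and if it is positive, \<open>W_B\<close> is not.
  As a function of \<open>x\<close> this discriminant is a cubic whose value at \<open>(a b + c - 4) / 2\<close> is
  \<open>F_poly a b c\<close>. It is decreasing up to that point, except when \<open>a\<close>, \<open>b\<close>, \<open>c\<close> are all close to 4,
  where \<open>F_poly a b c\<close> is negative unless \<open>a = b = c = 4\<close>. In that last case \<open>W_A\<close> never becomes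
  elliptic in the deformation space, which is empty if \<open>a = b = c = 1\<close>.
\<close>

subsection \<open>Hermitian form and complex reflections\<close>

lemma herm_add_left: "herm (u + v) w = herm u w + herm v w"
  and herm_add_right: "herm w (u + v) = herm w u + herm w v"
  and herm_diff_left: "herm (u - v) w = herm u w - herm v w"
  and herm_diff_right: "herm w (u - v) = herm w u - herm w v"
  and herm_minus_left: "herm (- u) w = - herm u w"
  and herm_minus_right: "herm w (- u) = - herm w u"
  and herm_scale_left: "herm (z *s u) w = z * herm u w"
  and herm_scale_right: "herm w (z *s u) = cnj z * herm w u"
  and herm_zero_left: "herm 0 w = 0"
  and herm_zero_right: "herm w 0 = 0"
  by (simp_all add: herm_def algebra_simps)

lemmas herm_simps = herm_add_left herm_add_right herm_diff_left herm_diff_right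
  herm_minus_left herm_minus_right herm_scale_left herm_scale_right herm_zero_left herm_zero_right

lemma herm_commute: "herm v u = cnj (herm u v)"
  by (simp add: herm_def mult.commute)

lemma herm_self: "herm v v = of_real (Re (herm v v))"
  by (simp add: complex_eq_iff herm_def mult.commute)

lemma Re_herm_self: "Re (herm v v) = (cmod (v$1))\<^sup>2 + (cmod (v$2))\<^sup>2 - (cmod (v$3))\<^sup>2"
  by (simp add: herm_def cmod_power2) (simp add: power2_eq_square)

lemma herm_self_scale: "Re (herm (z *s v) (z *s v)) = (cmod z)\<^sup>2 * Re (herm v v)"
  by (simp add: Re_herm_self norm_mult power_mult_distrib algebra_simps)

lemma vec3_eq_iff: "(u::complex^3) = v \<longleftrightarrow> u$1 = v$1 \<and> u$2 = v$2 \<and> u$3 = v$3"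
  by (simp add: vec_eq_iff forall_3)

text \<open>This is the reversed Cauchy--Schwarz inequality.\<close>

lemma positive_if_orthogonal_negative:
  assumes v: "Re (herm v v) < 0" and o: "herm w v = 0" and w: "w \<noteq> 0"
  shows "Re (herm w w) > 0"
proof (rule ccontr)
  assume neg: "\<not> Re (herm w w) > 0"
  define A where "A = (cmod (w$1))\<^sup>2 + (cmod (w$2))\<^sup>2"
  define B where "B = (cmod (v$1))\<^sup>2 + (cmod (v$2))\<^sup>2"
  have A: "A \<le> (cmod (w$3))\<^sup>2" and B: "B < (cmod (v$3))\<^sup>2"
    using neg v by (auto simp: A_def B_def Re_herm_self)
  have A0: "A \<ge> 0" and B0: "B \<ge> 0" by (auto simp: A_def B_def)
  have "w$3 * cnj (v$3) = w$1 * cnj (v$1) + w$2 * cnj (v$2)"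
    using o by (simp add: herm_def)
  then have "cmod (w$3) * cmod (v$3) = cmod (w$1 * cnj (v$1) + w$2 * cnj (v$2))"
    by (metis complex_mod_cnj norm_mult)
  also have "\<dots> \<le> cmod (w$1) * cmod (v$1) + cmod (w$2) * cmod (v$2)"
    by (metis complex_mod_cnj norm_mult norm_triangle_ineq)
  finally have "(cmod (w$3) * cmod (v$3))\<^sup>2 \<le> (cmod (w$1) * cmod (v$1) + cmod (w$2) * cmod (v$2))\<^sup>2"
    by (intro power_mono) auto
  \<comment> \<open>Cauchy--Schwarz for the first two coordinates: the difference of the two sides
    is the square of \<open>cmod (w$1) * cmod (v$2) - cmod (w$2) * cmod (v$1)\<close>.\<close>
  also have "\<dots> \<le> A * B"
    using sum_squares_ge_zero[of "cmod (w$1) * cmod (v$2) - cmod (w$2) * cmod (v$1)" 0]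
    by (simp add: A_def B_def power2_eq_square algebra_simps)
  finally have le: "(cmod (w$3))\<^sup>2 * (cmod (v$3))\<^sup>2 \<le> A * B" by (simp add: power_mult_distrib)
  have w3: "(cmod (w$3))\<^sup>2 = 0"
  proof (rule ccontr)
    assume "(cmod (w$3))\<^sup>2 \<noteq> 0"
    then have "(cmod (w$3))\<^sup>2 * B < (cmod (w$3))\<^sup>2 * (cmod (v$3))\<^sup>2"
      using B by (intro mult_strict_left_mono) auto
    moreover have "A * B \<le> (cmod (w$3))\<^sup>2 * B" using A B0 by (rule mult_right_mono)
    ultimately show False using le by simp
  qed
  then have "A = 0" using A A0 by simp
  then have "w$1 = 0" "w$2 = 0" by (simp_all add: A_def add_nonneg_eq_0_iff)
  with w3 w show False by (simp add: vec3_eq_iff)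
qed

section \<open>Reflections as linear isometries, and ellipticity\<close>

definition clinear_map :: "(complex^3 \<Rightarrow> complex^3) \<Rightarrow> bool" where
  "clinear_map g \<longleftrightarrow> (\<forall>u v. g (u + v) = g u + g v) \<and> (\<forall>z u. g (z *s u) = z *s g u)"

lemma complex_reflection_scale:
  assumes "z \<noteq> 0" shows "complex_reflection (z *s c) = complex_reflection c"
  using assms by (auto simp: complex_reflection_def fun_eq_iff vec3_eq_iff herm_simps)

lemma complex_reflection_unit:
  assumes "herm c c = 1" shows "complex_reflection c v = - v + (2 * herm v c) *s c"
  using assms by (simp add: complex_reflection_def)

lemma complex_reflection_involution:
  assumes "herm c c = 1" shows "complex_reflection c (complex_reflection c v) = v"
  using assms
  by (simp add: complex_reflection_unit herm_simps vec3_eq_iff algebra_simps)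

lemma clinear_complex_reflection: "clinear_map (complex_reflection c)"
  by (simp add: clinear_map_def complex_reflection_def herm_simps vec3_eq_iff
      algebra_simps add_divide_distrib)

lemma herm_complex_reflection:
  assumes "herm c c = 1"
  shows "herm (complex_reflection c u) (complex_reflection c v) = herm u v"
  using assms herm_commute[of c v]
  by (simp add: complex_reflection_unit herm_simps algebra_simps)

lemma complex_reflection_adjoint:
  assumes "herm c c = 1"
  shows "herm (complex_reflection c u) v = herm u (complex_reflection c v)"
  using herm_complex_reflection[OF assms, of u "complex_reflection c v"]
  by (simp add: complex_reflection_involution assms)

text \<open>Adjointness moves the outer isometry onto the polar vector. This turns
  \<open>I_3 I_2 I_3\<close> into a single reflection.\<close>

lemma conjugate_complex_reflection:
  assumes "herm c c = 1" "herm d d = 1"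
  shows "complex_reflection d (complex_reflection c (complex_reflection d v))
    = complex_reflection (complex_reflection d c) v"
proof -
  have "herm (complex_reflection d c) (complex_reflection d c) = 1"
    using assms by (simp add: herm_complex_reflection)
  moreover have "complex_reflection d (complex_reflection c (complex_reflection d v))
     = - v + (2 * herm (complex_reflection d v) c) *s complex_reflection d c"
  proof -
    define w where "w = complex_reflection d v"
    have "complex_reflection d (- w + y *s c) = - complex_reflection d w + y *s complex_reflection d c" for y
      by (simp add: complex_reflection_def herm_simps vec3_eq_iff algebra_simps
          add_divide_distrib diff_divide_distrib)
    moreover have "complex_reflection d w = v"
      by (simp add: w_def complex_reflection_involution assms)
    ultimately show ?thesis by (simp add: complex_reflection_unit[OF assms(1)] w_def)
  qed
  ultimately show ?thesis
    by (simp add: complex_reflection_unit complex_reflection_adjoint[OF assms(2)])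
qed

text \<open>Turns fixed points into linear algebra: on an invariant punctured line a linear map is a
  scaling, and a nonzero factor makes it onto.\<close>

lemma elliptic_iff_eigenvector:
  assumes "clinear_map g"
  shows "elliptic g \<longleftrightarrow> (\<exists>v z. Re (herm v v) < 0 \<and> z \<noteq> 0 \<and> g v = z *s v)"
proof
  assume "elliptic g"
  then obtain v where v: "Re (herm v v) < 0" "g ` proj_class v = proj_class v"
    by (auto simp: elliptic_def complex_hyperbolic_plane_def)
  have "v \<in> proj_class v" by (auto simp: proj_class_def intro!: exI[of _ 1])
  then have "g v \<in> proj_class v" using v(2) by blast
  then show "\<exists>v z. Re (herm v v) < 0 \<and> z \<noteq> 0 \<and> g v = z *s v"
    using v(1) by (auto simp: proj_class_def)
next
  assume "\<exists>v z. Re (herm v v) < 0 \<and> z \<noteq> 0 \<and> g v = z *s v"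
  then obtain v z where v: "Re (herm v v) < 0" "z \<noteq> 0" "g v = z *s v" by blast
  have g: "g (y *s v) = (y * z) *s v" for y
    using assms v(3) by (simp add: clinear_map_def)
  have "g ` proj_class v = proj_class v"
  proof
    show "g ` proj_class v \<subseteq> proj_class v" using v(2) g by (auto simp: proj_class_def)
    show "proj_class v \<subseteq> g ` proj_class v"
    proof
      fix w assume "w \<in> proj_class v"
      then obtain y where y: "w = y *s v" "y \<noteq> 0" by (auto simp: proj_class_def)
      have "w = g ((y / z) *s v)" using v(2) y by (simp add: g)
      moreover have "(y / z) *s v \<in> proj_class v" using v(2) y by (auto simp: proj_class_def)
      ultimately show "w \<in> g ` proj_class v" by blast
    qed
  qed
  then show "elliptic g" using v(1) by (auto simp: elliptic_def complex_hyperbolic_plane_def)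
qed

section \<open>Complex geodesics and their polar vectors\<close>

lemma complex_geodesic_orthogonal:
  "complex_geodesic c = proj_class ` {v. Re (herm v v) < 0 \<and> herm v c = 0}"
proof -
  have "(\<forall>w\<in>proj_class v. herm w c = 0) \<longleftrightarrow> herm v c = 0" for v
    by (auto simp: proj_class_def herm_simps dest: spec[of _ v])
  then show ?thesis unfolding complex_geodesic_def complex_hyperbolic_plane_def by blast
qed

text \<open>The third basis vector has norm -1; removing its component along the positive vector
  \<open>c\<close> can only lower the norm.\<close>

lemma negative_orthogonal_exists:
  assumes "Re (herm c c) > 0"
  obtains v where "Re (herm v v) < 0" "herm v c = 0"
proof -
  define k where "k = Re (herm c c)"
  have k: "herm c c = of_real k" "k > 0" using assms herm_self by (auto simp: k_def)
  define e :: "complex^3" where "e = (\<chi> i. if i = 3 then 1 else 0)"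
  have e: "e$1 = 0" "e$2 = 0" "e$3 = 1" by (simp_all add: e_def)
  define v where "v = e - (herm e c / herm c c) *s c"
  have o: "herm v c = 0" using k by (simp add: v_def herm_simps)
  have "herm v v = herm v e" using o herm_commute[of v c]
    by (simp add: v_def herm_simps)
  also have "\<dots> = - 1 - c$3 * cnj (c$3) / k"
    by (simp add: v_def herm_simps k) (simp add: herm_def e)
  finally have "Re (herm v v) = - 1 - (cmod (c$3))\<^sup>2 / k"
    by (simp add: complex_norm_square[symmetric] flip: of_real_divide of_real_power)
  moreover have "(cmod (c$3))\<^sup>2 / k \<ge> 0" using k(2) by simp
  ultimately have "Re (herm v v) < 0" by linarith
  with o show thesis using that by blast
qed

text \<open>The negative vectors orthogonal to \<open>c\<close> determine its whole orthogonal
  complement, so \<open>c'\<close> is orthogonal to that complement too.\<close>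

lemma polar_vector_unique:
  assumes c: "Re (herm c c) > 0" and c': "Re (herm c' c') > 0"
    and eq: "complex_geodesic c = complex_geodesic c'"
  obtains z where "z \<noteq> 0" "c' = z *s c"
proof -
  have neg: "herm v c' = 0" if "Re (herm v v) < 0" "herm v c = 0" for v
  proof -
    have "proj_class v \<in> complex_geodesic c'"
      using that eq unfolding complex_geodesic_orthogonal[of c] by blast
    moreover have "v \<in> proj_class v" by (auto simp: proj_class_def intro!: exI[of _ 1])
    ultimately show ?thesis by (auto simp: complex_geodesic_def)
  qed
  obtain v where v: "Re (herm v v) < 0" "herm v c = 0" using negative_orthogonal_exists[OF c] .
  have perp: "herm w c' = 0" if w: "herm w c = 0" for w
  proof -
    \<comment> \<open>A negative vector stays negative after a small step along \<open>w\<close>;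
      \<open>e\<close> is small enough to absorb the mixed and the quadratic term.\<close>
    define e where "e = - Re (herm v v) / (2 * (\<bar>Re (herm v w)\<bar> + \<bar>Re (herm w w)\<bar> - Re (herm v v)))"
    have e: "e > 0" "e \<le> 1/2" using v(1) by (auto simp: e_def field_simps)
    have "\<bar>Re (herm v w)\<bar> + \<bar>Re (herm w w)\<bar> - Re (herm v v) \<noteq> 0" using v(1) by linarith
    then have e': "2 * e * (\<bar>Re (herm v w)\<bar> + \<bar>Re (herm w w)\<bar> - Re (herm v v)) = - Re (herm v v)"
      by (simp add: e_def field_simps)
    define u where "u = v + of_real e *s w"
    have "Re (herm u u) = Re (herm v v) + 2 * e * Re (herm v w) + e * e * Re (herm w w)"
      using herm_commute[of w v] by (simp add: u_def herm_simps algebra_simps)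
    also have "\<dots> \<le> Re (herm v v) + 2 * e * \<bar>Re (herm v w)\<bar> + e * \<bar>Re (herm w w)\<bar>"
    proof -
      have "e * Re (herm v w) \<le> e * \<bar>Re (herm v w)\<bar>"
        using e(1) by (intro mult_left_mono) auto
      moreover have "e * e * Re (herm w w) \<le> e * e * \<bar>Re (herm w w)\<bar>"
        using e(1) by (intro mult_left_mono) auto
      moreover have "e * e * \<bar>Re (herm w w)\<bar> \<le> e * 1 * \<bar>Re (herm w w)\<bar>"
        using e by (intro mult_right_mono mult_left_mono) auto
      ultimately show ?thesis by linarith
    qed
    also have "\<dots> < 0"
    proof -
      have "e * \<bar>Re (herm w w)\<bar> \<ge> 0" "e * Re (herm v v) < 0"
        using e v(1) by (auto simp: mult_pos_neg)
      then show ?thesis using e' by (simp add: algebra_simps)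
    qed
    finally have "Re (herm u u) < 0" .
    moreover have "herm u c = 0" using v w by (simp add: u_def herm_simps)
    ultimately have "herm u c' = 0" by (rule neg)
    moreover have "herm v c' = 0" using v by (rule neg)
    ultimately show ?thesis using e by (simp add: u_def herm_simps)
  qed
  define z where "z = herm c' c / herm c c"
  \<comment> \<open>The component of \<open>c'\<close> orthogonal to \<open>c\<close> is null and
    orthogonal to a negative vector, so it vanishes.\<close>
  define w where "w = c' - z *s c"
  have cc: "herm c c \<noteq> 0" using c by auto
  have wc: "herm w c = 0" using cc by (simp add: w_def z_def herm_simps)
  then have "herm w c' = 0" by (rule perp)
  then have "herm w w = 0" using wc by (simp add: w_def herm_simps)
  moreover have "herm w v = 0"
    using perp[OF v(2)] v(2) herm_commute[of v c'] herm_commute[of v c] by (simp add: w_def herm_simps)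
  ultimately have "w = 0" using positive_if_orthogonal_negative[OF v(1), of w] by auto
  then have "c' = z *s c" by (simp add: w_def)
  moreover from this have "z \<noteq> 0" using c' by (auto simp: herm_simps)
  ultimately show thesis using that by blast
qed

section \<open>Products of two reflections and the word \<open>W_A\<close>\<close>

lemma negative_orthogonal_to_pair:
  assumes "Re (herm c c * herm d d - herm c d * herm d c) > 0"
  obtains v where "Re (herm v v) < 0" "herm v c = 0" "herm v d = 0"
proof -
  \<comment> \<open>The Hermitian cross product; its norm is minus the Gram determinant of
    \<open>c\<close> and \<open>d\<close>.\<close>
  define v :: "complex^3" where "v = vector [cnj (c$2 * d$3 - c$3 * d$2),
    cnj (c$3 * d$1 - c$1 * d$3), - cnj (c$1 * d$2 - c$2 * d$1)]"
  have v: "v$1 = cnj (c$2 * d$3 - c$3 * d$2)" "v$2 = cnj (c$3 * d$1 - c$1 * d$3)"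
    "v$3 = - cnj (c$1 * d$2 - c$2 * d$1)" by (simp_all add: v_def)
  have "herm v v = herm c d * herm d c - herm c c * herm d d"
    unfolding herm_def v by (simp add: algebra_simps)
  then have "Re (herm v v) < 0" using assms by simp
  moreover have "herm v c = 0" "herm v d = 0"
    unfolding herm_def v by (simp_all add: algebra_simps)
  ultimately show thesis using that by blast
qed

lemma isometry_eigenvalue_norm:
  assumes "\<And>u v. herm (g u) (g v) = herm u v" and "g v = z *s v" and "Re (herm v v) \<noteq> 0"
  shows "cmod z = 1"
proof -
  have "herm (z *s v) (z *s v) = herm v v" using assms(1)[of v v] assms(2) by simp
  then have "(cmod z)\<^sup>2 * Re (herm v v) = Re (herm v v)" using herm_self_scale[of z v] by simp
  then show ?thesis using assms(3) by (simp add: abs_square_eq_1)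
qed

text \<open>For \<open>cmod (herm c d) < 1\<close> the two geodesics share a point, fixed by both
  reflections. The last assumption excludes that \<open>d\<close> is a unit multiple of
  \<open>c\<close>, where the product is the identity and hence elliptic.\<close>

lemma elliptic_two_reflections:
  assumes c: "herm c c = 1" and d: "herm d d = 1"
    and indep: "cmod (herm c d) = 1 \<Longrightarrow> d \<noteq> herm d c *s c"
  shows "elliptic (complex_reflection c \<circ> complex_reflection d) \<longleftrightarrow> cmod (herm c d) < 1"
proof -
  let ?g = "complex_reflection c \<circ> complex_reflection d"
  have lin: "clinear_map ?g"
    using clinear_complex_reflection by (simp add: clinear_map_def)
  show ?thesis
  proof
    assume "cmod (herm c d) < 1"
    then have "(cmod (herm c d))\<^sup>2 < 1" by (simp add: power_less_one_iff)
    moreover have "herm c d * herm d c = of_real ((cmod (herm c d))\<^sup>2)"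
      using complex_norm_square[of "herm c d"] herm_commute[of d c] by simp
    ultimately have "Re (herm c c * herm d d - herm c d * herm d c) > 0" using c d by simp
    from negative_orthogonal_to_pair[OF this] obtain v
      where v: "Re (herm v v) < 0" "herm v c = 0" "herm v d = 0" .
    have "?g v = 1 *s v" using v(2,3) c d
      by (simp add: complex_reflection_unit herm_minus_left vec3_eq_iff)
    then show "elliptic ?g" unfolding elliptic_iff_eigenvector[OF lin]
      using v(1) by (intro exI[of _ v] exI[of _ 1]) auto
  next
    assume "elliptic ?g"
    then obtain v z where v: "Re (herm v v) < 0" and gv: "?g v = z *s v"
      unfolding elliptic_iff_eigenvector[OF lin] by blast
    have z: "cmod z = 1"
      using isometry_eigenvalue_norm[where g = "?g", OF _ gv] v by (simp add: herm_complex_reflection c d)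
    define x where "x = herm v c"
    define y where "y = herm v d"
    define k where "k = herm c d"
    have k': "herm d c = cnj k" using herm_commute[of d c] by (simp add: k_def)
    \<comment> \<open>Reflections are involutions, so the eigenvector equation says
      \<open>I_d v = z I_c v\<close>; pairing it with \<open>c\<close> and \<open>d\<close> gives a
      linear system for \<open>x\<close> and \<open>y\<close>.\<close>
    have "complex_reflection d v = complex_reflection c (z *s v)"
      using arg_cong[OF gv, of "complex_reflection c"] by (simp add: complex_reflection_involution c)
    then have eq: "(z - 1) *s v + (2 * y) *s d = (2 * z * x) *s c"
      by (simp add: complex_reflection_unit c d x_def y_def herm_simps vec3_eq_iff)
         (simp add: algebra_simps)
    have "2 * y * cnj k - x = x * z"
      using arg_cong[OF eq, of "\<lambda>w. herm w c"] by (simp add: herm_simps c d k' flip: x_def)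
    then have e1: "(z + 1) * x = 2 * y * cnj k" by (simp add: algebra_simps)
    have "y + z * y = 2 * z * x * k"
      using arg_cong[OF eq, of "\<lambda>w. herm w d"] by (simp add: herm_simps c d flip: y_def k_def)
    then have e2: "(z + 1) * y = 2 * z * x * k" by (simp add: algebra_simps)
    have kk: "k * cnj k = of_real ((cmod k)\<^sup>2)" using complex_norm_square[of k] by simp
    have "(z + 1) * ((z + 1) * x) = 2 * cnj k * ((z + 1) * y)" unfolding e1 by (simp add: algebra_simps)
    also have "\<dots> = 4 * z * (k * cnj k) * x" unfolding e2 by (simp add: algebra_simps)
    finally have main: "(z + 1)\<^sup>2 * x = 4 * z * of_real ((cmod k)\<^sup>2) * x"
      by (simp add: kk power2_eq_square algebra_simps)
    show "cmod (herm c d) < 1"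
    proof (rule ccontr)
      assume "\<not> cmod (herm c d) < 1"
      then have k1: "cmod k \<ge> 1" by (simp add: k_def)
      have z1: "z = 1"
      proof (cases "x = 0")
        case True
        then have "y = 0" using e1 k1 by auto
        with True eq have "(z - 1) *s v = 0" by (simp add: vec3_eq_iff)
        moreover have "v \<noteq> 0" using v by (auto simp: herm_simps)
        ultimately show ?thesis by (metis vector_mul_eq_0 right_minus_eq)
      next
        case False
        then have sq: "(z + 1)\<^sup>2 = 4 * z * of_real ((cmod k)\<^sup>2)" using main by simp
        \<comment> \<open>As \<open>cmod z = 1\<close>, absolute values give
          \<open>2 + 2 Re z = 4 |k|^2 \<ge> 4\<close>, which forces \<open>z = 1\<close>.\<close>
        then have "(cmod (z + 1))\<^sup>2 = 4 * (cmod k)\<^sup>2"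
          using z by (simp add: norm_mult flip: norm_power)
        moreover have "(cmod k)\<^sup>2 \<ge> 1" using k1 by (simp add: one_le_power)
        moreover have zz: "(Re z)\<^sup>2 + (Im z)\<^sup>2 = 1" using z by (metis cmod_power2 one_power2)
        moreover have "(cmod (z + 1))\<^sup>2 = 2 + 2 * Re z"
          unfolding cmod_power2 using zz by (simp add: power2_eq_square algebra_simps)
        ultimately have "Re z \<ge> 1" by linarith
        moreover have "Re z \<le> 1" using z complex_Re_le_cmod[of z] by simp
        ultimately have "Re z = 1" by simp
        then show ?thesis using zz by (simp add: complex_eq_iff)
      qed
      have yd: "y *s d = x *s c" using eq z1 by (simp add: vec3_eq_iff)
      \<comment> \<open>The component of \<open>d\<close> orthogonal to \<open>c\<close> has norm
        \<open>1 - |k|^2 \<le> 0\<close>, yet it is nonzero and orthogonal to the negative vector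
        \<open>v\<close>, hence positive.\<close>
      define w where "w = d - cnj k *s c"
      have "herm w v = 0"
      proof (cases "x = 0 \<or> y = 0")
        case True
        have "c \<noteq> 0" "d \<noteq> 0" using c d by (auto simp: herm_simps)
        then have "x = 0" "y = 0" using yd True by (auto simp: vec3_eq_iff)
        then show ?thesis using herm_commute[of c v] herm_commute[of d v]
          by (simp add: w_def herm_simps x_def y_def)
      next
        case False
        have "d = (x / y) *s c" using yd False by (simp add: vec3_eq_iff field_simps)
        from arg_cong[OF this, of "\<lambda>w. herm w c"] have "herm d c = x / y" by (simp add: herm_simps c)
        then have "w = 0" using \<open>d = (x / y) *s c\<close> by (simp add: w_def flip: k')
        then show ?thesis by (simp add: herm_simps)
      qed
      moreover have "w \<noteq> 0"
      proof
        assume "w = 0"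
        then have dk: "d = herm d c *s c" unfolding w_def k' right_minus_eq .
        have "herm d d = herm (herm d c *s c) d"
          using dk by (rule arg_cong[where f = "\<lambda>w. herm w d"])
        then have "herm d d = herm d c * herm c d" unfolding herm_scale_left .
        then have "of_real ((cmod k)\<^sup>2) = (1::complex)"
          using kk unfolding d k' k_def[symmetric] by (simp only: mult.commute)
        then have "(cmod k)\<^sup>2 = 1" using of_real_eq_1_iff by blast
        then have "cmod k = 1" by (simp add: abs_square_eq_1)
        then show False using indep dk unfolding k_def by blast
      qed
      ultimately have "Re (herm w w) > 0" using positive_if_orthogonal_negative[OF v] by blast
      moreover have "herm w w = 1 - of_real ((cmod k)\<^sup>2)"
        unfolding kk[symmetric] by (simp add: w_def herm_simps c d k' algebra_simps flip: k_def)
      moreover have "(cmod k)\<^sup>2 \<ge> 1" using k1 by (simp add: one_le_power)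
      ultimately show False by simp
    qed
  qed
qed

text \<open>The last assumption is negativity of the Gram determinant; for a triangle it says that
  \<open>t\<close> lies below the first bound in \<open>t_upper\<close>.\<close>

locale unit_triple =
  fixes c1 c2 c3 :: "complex^3"
  assumes unit: "herm c1 c1 = 1" "herm c2 c2 = 1" "herm c3 c3 = 1"
    and gram_negative: "1 - (cmod (herm c1 c2))\<^sup>2 - (cmod (herm c1 c3))\<^sup>2 - (cmod (herm c2 c3))\<^sup>2
      + 2 * Re (herm c1 c2 * herm c2 c3 * herm c3 c1) < 0"
begin

abbreviation "g12 \<equiv> herm c1 c2"
abbreviation "g13 \<equiv> herm c1 c3"
abbreviation "g21 \<equiv> herm c2 c1"
abbreviation "g23 \<equiv> herm c2 c3"
abbreviation "g31 \<equiv> herm c3 c1"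
abbreviation "g32 \<equiv> herm c3 c2"

lemma gram_nonzero:
  "1 - g12 * g21 - g13 * g31 - g23 * g32 + g12 * g23 * g31 + g21 * g32 * g13 \<noteq> 0" (is "?d \<noteq> 0")
proof -
  have "Re ?d < 0"
    using gram_negative herm_commute[of c2 c1] herm_commute[of c3 c1] herm_commute[of c3 c2]
    unfolding cmod_power2 by (simp add: power2_eq_square algebra_simps)
  then show ?thesis by (metis less_irrefl zero_complex.simps(1))
qed

lemma independent:
  assumes "x *s c1 + y *s c2 + z *s c3 = 0"
  shows "x = 0 \<and> y = 0 \<and> z = 0"
proof -
  let ?d = "1 - g12 * g21 - g13 * g31 - g23 * g32 + g12 * g23 * g31 + g21 * g32 * g13"
  have e: "herm (x *s c1 + y *s c2 + z *s c3) w = 0" for w using assms by (simp add: herm_simps)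
  have e1: "x + y * g21 + z * g31 = 0" and e2: "x * g12 + y + z * g32 = 0"
    and e3: "x * g13 + y * g23 + z = 0"
    using e[of c1] e[of c2] e[of c3] by (simp_all add: herm_simps unit)
  \<comment> \<open>Cramer's rule: the coefficients are cofactors of the Gram matrix.\<close>
  have "?d * x = (1 - g32 * g23) * (x + y * g21 + z * g31)
      - (g21 - g31 * g23) * (x * g12 + y + z * g32) + (g21 * g32 - g31) * (x * g13 + y * g23 + z)"
    by (simp add: algebra_simps)
  then have "x = 0" unfolding e1 e2 e3 using gram_nonzero by simp
  have "?d * y = (g32 * g13 - g12) * (x + y * g21 + z * g31)
      + (1 - g31 * g13) * (x * g12 + y + z * g32) + (g31 * g12 - g32) * (x * g13 + y * g23 + z)"
    by (simp add: algebra_simps)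
  then have "y = 0" unfolding e1 e2 e3 using gram_nonzero by simp
  with \<open>x = 0\<close> e3 show ?thesis by simp
qed

text \<open>Conjugation leaves a product of two reflections; linear independence keeps their polar
  vectors from being proportional.\<close>

lemma elliptic_word_A_iff:
  "elliptic (complex_reflection c1 \<circ> complex_reflection c3 \<circ> complex_reflection c2 \<circ> complex_reflection c3)
    \<longleftrightarrow> (cmod g12)\<^sup>2 + 4 * (cmod g13)\<^sup>2 * (cmod g23)\<^sup>2 - 4 * Re (g12 * g23 * g31) < 1"
proof -
  define d where "d = complex_reflection c3 c2"
  have d: "d = - c2 + (2 * g23) *s c3" by (simp add: d_def complex_reflection_unit unit)
  have dd: "herm d d = 1" by (simp add: d_def herm_complex_reflection unit)
  have fn: "complex_reflection c1 \<circ> complex_reflection c3 \<circ> complex_reflection c2 \<circ> complex_reflection c3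
    = complex_reflection c1 \<circ> complex_reflection d"
    by (auto simp: fun_eq_iff d_def conjugate_complex_reflection unit)
  have "d \<noteq> herm d c1 *s c1"
  proof
    assume "d = herm d c1 *s c1"
    then have "herm d c1 *s c1 + 1 *s c2 + (- (2 * g23)) *s c3 = 0"
      unfolding d by (simp add: vec3_eq_iff algebra_simps)
    from independent[OF this] show False by simp
  qed
  then have "elliptic (complex_reflection c1 \<circ> complex_reflection d) \<longleftrightarrow> cmod (herm c1 d) < 1"
    by (intro elliptic_two_reflections unit dd)
  moreover have "(cmod (herm c1 d))\<^sup>2
    = (cmod g12)\<^sup>2 + 4 * (cmod g13)\<^sup>2 * (cmod g23)\<^sup>2 - 4 * Re (g12 * g23 * g31)"
  proof -
    have "herm c1 d = - g12 + 2 * cnj g23 * g13" by (simp add: d herm_simps)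
    then show ?thesis using herm_commute[of c3 c1]
      by (simp add: cmod_power2) (simp add: power2_eq_square algebra_simps)
  qed
  moreover have "cmod (herm c1 d) < 1 \<longleftrightarrow> (cmod (herm c1 d))\<^sup>2 < 1"
    by (simp add: abs_square_less_1)
  ultimately show ?thesis unfolding fn by simp
qed

end

subsection \<open>Goldman's discriminant\<close>

definition goldman :: "complex \<Rightarrow> real" where
  "goldman \<tau> = (cmod \<tau>) ^ 4 - 8 * Re (\<tau> ^ 3) + 18 * (cmod \<tau>)\<^sup>2 - 27"

text \<open>Vieta's relations, stated for a triple so that multiplicities are kept.\<close>

definition char_roots :: "complex \<Rightarrow> complex \<Rightarrow> complex \<Rightarrow> complex \<Rightarrow> bool" where
  "char_roots \<tau> k l m \<longleftrightarrow> k + l + m = \<tau> \<and> k * l + k * m + l * m = cnj \<tau> \<and> k * l * m = 1"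

text \<open>One root comes from the fundamental theorem of algebra, the other two from the quadratic
  formula for the remaining factor.\<close>

lemma char_roots_exist: "\<exists>k l m. char_roots \<tau> k l m"
proof -
  have "\<not> constant (poly [:-1, cnj \<tau>, -\<tau>, 1:])" by (simp add: constant_degree)
  then obtain k where "poly [:-1, cnj \<tau>, -\<tau>, 1:] k = 0"
    using fundamental_theorem_of_algebra by blast
  then have k: "k * (cnj \<tau> - \<tau> * k + k * k) = 1" by (simp add: algebra_simps)
  define d where "d = csqrt ((\<tau> - k)\<^sup>2 - 4 * (cnj \<tau> - \<tau> * k + k * k))"
  have d: "d * d = (\<tau> - k)\<^sup>2 - 4 * (cnj \<tau> - \<tau> * k + k * k)"
    unfolding d_def power2_eq_square[symmetric] by simp
  define l where "l = ((\<tau> - k) + d) / 2"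
  define m where "m = ((\<tau> - k) - d) / 2"
  have s: "k + l + m = \<tau>" by (simp add: l_def m_def field_simps)
  have p: "l * m = cnj \<tau> - \<tau> * k + k * k"
    using d by (simp add: l_def m_def field_simps power2_eq_square)
  have "k * l + k * m + l * m = k * (\<tau> - k) + l * m"
    unfolding s[symmetric] by (simp add: algebra_simps)
  also have "\<dots> = cnj \<tau>" unfolding p by (simp add: algebra_simps)
  finally have "char_roots \<tau> k l m"
    using s k by (simp add: char_roots_def mult.assoc p)
  then show ?thesis by blast
qed

lemma char_roots_permute:
  assumes "char_roots \<tau> k l m"
  shows "char_roots \<tau> l k m" "char_roots \<tau> k m l" "char_roots \<tau> m l k"
  using assms by (simp_all add: char_roots_def algebra_simps)

lemma goldman_discriminant:
  assumes "char_roots \<tau> k l m"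
  shows "of_real (goldman \<tau>) = ((k - l) * (k - m) * (l - m))\<^sup>2"
proof -
  have \<tau>: "\<tau> = k + l + m" and \<tau>': "cnj \<tau> = k * l + k * m + l * m" and one: "k * l * m = 1"
    using assms by (auto simp: char_roots_def)
  have N: "of_real ((cmod \<tau>)\<^sup>2) = \<tau> * cnj \<tau>" by (rule complex_norm_square)
  have "of_real (2 * Re (\<tau> ^ 3)) = \<tau> ^ 3 + cnj \<tau> ^ 3"
    by (simp only: complex_add_cnj complex_cnj_power[symmetric])
  then have R: "of_real (8 * Re (\<tau> ^ 3)) = 4 * (\<tau> ^ 3 + cnj \<tau> ^ 3)"
    by (simp flip: \<open>of_real (2 * Re (\<tau> ^ 3)) = _\<close>)
  have Q: "of_real ((cmod \<tau>) ^ 4) = (\<tau> * cnj \<tau>)\<^sup>2" unfolding N[symmetric] by simp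
  have "of_real (goldman \<tau>) = of_real ((cmod \<tau>) ^ 4) - of_real (8 * Re (\<tau> ^ 3))
      + 18 * of_real ((cmod \<tau>)\<^sup>2) - (27 :: complex)"
    by (simp add: goldman_def)
  also have "\<dots> = (\<tau> * cnj \<tau>)\<^sup>2 - 4 * (\<tau> ^ 3 + cnj \<tau> ^ 3) + 18 * (\<tau> * cnj \<tau>) - 27"
    unfolding N Q R by simp
  \<comment> \<open>Powers of \<open>k * l * m = 1\<close> make every term homogeneous of degree 6
    in the roots; the rest is a polynomial identity.\<close>
  also have "\<dots> = (\<tau> * cnj \<tau>)\<^sup>2 - 4 * (\<tau> ^ 3 * (k * l * m) + cnj \<tau> ^ 3)
      + 18 * (\<tau> * cnj \<tau>) * (k * l * m) - 27 * (k * l * m)\<^sup>2"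
    by (simp add: one)
  also have "\<dots> = ((k - l) * (k - m) * (l - m))\<^sup>2"
    unfolding \<tau>' unfolding \<tau> by (simp add: power2_eq_square power3_eq_cube algebra_simps)
  finally show ?thesis .
qed

text \<open>Conjugation inverts roots on the unit circle, so with \<open>k * l * m = 1\<close> the
  product of differences satisfies \<open>cnj d = - d\<close> and has a square \<le> 0.\<close>

lemma goldman_nonpos:
  assumes r: "char_roots \<tau> k l m" and u: "cmod k = 1" "cmod l = 1" "cmod m = 1"
  shows "goldman \<tau> \<le> 0"
proof -
  define d where "d = (k - l) * (k - m) * (l - m)"
  have one: "k * l * m = 1" using r by (simp add: char_roots_def)
  have c: "x * cnj x = 1" if "cmod x = 1" for x using complex_norm_square[of x] that by simp
  have sub: "x * y * cnj (x - y) = - (x - y)" if "cmod x = 1" "cmod y = 1" for x y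
    using c[OF that(1)] c[OF that(2)]
    by (simp add: algebra_simps)
  have "cnj d = (k * l * m) * (k * l * m) * cnj d" by (simp add: one)
  also have "\<dots> = (k * l * cnj (k - l)) * (k * m * cnj (k - m)) * (l * m * cnj (l - m))"
    by (simp add: d_def)
  also have "\<dots> = - d" unfolding sub[OF u(1) u(2)] sub[OF u(1) u(3)] sub[OF u(2) u(3)] d_def
    by (simp only: mult_minus_left mult_minus_right minus_minus)
  finally have "d = - cnj d" by simp
  then have "d\<^sup>2 = - (d * cnj d)" by (metis minus_mult_right power2_eq_square)
  also have "\<dots> = of_real (- ((cmod d)\<^sup>2))" by (simp only: complex_norm_square of_real_minus)
  finally have "of_real (goldman \<tau>) = (of_real (- ((cmod d)\<^sup>2)) :: complex)"
    using goldman_discriminant[OF r] by (simp add: d_def)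
  then have "goldman \<tau> = - ((cmod d)\<^sup>2)" unfolding of_real_eq_iff .
  then show ?thesis by simp
qed

text \<open>Conjugating and reversing the coefficients of the characteristic polynomial gives its
  negative, so inversion in the unit circle maps roots to roots.\<close>

lemma char_roots_inverse_cnj:
  assumes "char_roots \<tau> k l m"
  shows "1 / cnj k = k \<or> 1 / cnj k = l \<or> 1 / cnj k = m"
proof -
  define x where "x = 1 / cnj k"
  have one: "k * l * m = 1" and \<tau>: "\<tau> = k + l + m" and \<tau>': "cnj \<tau> = k * l + k * m + l * m"
    using assms by (auto simp: char_roots_def)
  have k0: "k \<noteq> 0" using one by auto
  have "k ^ 3 - \<tau> * k ^ 2 + cnj \<tau> * k - k * l * m = 0"
    unfolding \<tau>' unfolding \<tau> by (simp add: power2_eq_square power3_eq_cube algebra_simps)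
  then have "k ^ 3 - \<tau> * k ^ 2 + cnj \<tau> * k - 1 = 0" using one by simp
  then have "cnj (k ^ 3 - \<tau> * k ^ 2 + cnj \<tau> * k - 1) = 0" by simp
  then have "cnj k ^ 3 - cnj \<tau> * cnj k ^ 2 + \<tau> * cnj k - 1 = 0" by simp
  then have "1 - cnj \<tau> * x + \<tau> * x ^ 2 - x ^ 3 = 0"
    using k0 by (simp add: x_def field_simps power2_eq_square power3_eq_cube)
  moreover have "(x - k) * (x - l) * (x - m) = x ^ 3 - \<tau> * x ^ 2 + cnj \<tau> * x - k * l * m"
    unfolding \<tau>' unfolding \<tau> by (simp add: power2_eq_square power3_eq_cube algebra_simps)
  ultimately have "(x - k) * (x - l) * (x - m) = 0" unfolding one by (simp add: algebra_simps)
  then show ?thesis unfolding x_def by auto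
qed

text \<open>Inversion in the unit circle then takes \<open>k\<close> to \<open>l\<close>,
  \<open>l\<close> to \<open>k\<close> and fixes \<open>m\<close>, so the product of differences is
  real.\<close>

lemma goldman_nonneg:
  assumes r: "char_roots \<tau> k l m" and l: "1 / cnj k = l"
  shows "goldman \<tau> \<ge> 0"
proof -
  define d where "d = (k - l) * (k - m) * (l - m)"
  have one: "k * l * m = 1" using r by (simp add: char_roots_def)
  then have nz: "k \<noteq> 0" "l \<noteq> 0" "m \<noteq> 0" by auto
  have k': "cnj k = 1 / l" and l': "cnj l = 1 / k" using l nz by auto
  have "cnj k * cnj l * cnj m = 1" using arg_cong[OF one, of cnj] by simp
  then have m': "cnj m = k * l" using nz by (simp add: k' l' field_simps)
  have m: "m = 1 / (k * l)" using one nz by (simp add: field_simps)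
  have "cnj d = d" unfolding d_def complex_cnj_mult complex_cnj_diff k' l' m' unfolding m
    using nz by (simp add: field_simps)
  then have "d = of_real (Re d)" by (metis complex_cnj_cancel_iff Reals_cnj_iff of_real_Re)
  then have "d\<^sup>2 = of_real ((Re d)\<^sup>2)" by (metis of_real_power)
  then have "of_real (goldman \<tau>) = (of_real ((Re d)\<^sup>2) :: complex)"
    using goldman_discriminant[OF r] by (simp add: d_def)
  then have "goldman \<tau> = (Re d)\<^sup>2" unfolding of_real_eq_iff .
  then show ?thesis by simp
qed

lemma goldman_distinct:
  assumes "char_roots \<tau> k l m" "goldman \<tau> \<noteq> 0"
  shows "k \<noteq> l" "k \<noteq> m" "l \<noteq> m"
  using goldman_discriminant[OF assms(1)] assms(2) by auto

lemma unit_if_inverse_cnj: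
  assumes "1 / cnj k = k" "k \<noteq> 0" shows "cmod k = 1"
proof -
  have "k * cnj k = 1" using assms by (simp add: field_simps)
  then have "(of_real ((cmod k)\<^sup>2) :: complex) = of_real 1"
    by (simp only: complex_norm_square of_real_1)
  then show ?thesis unfolding of_real_eq_iff by (simp add: abs_square_eq_1)
qed

text \<open>If inversion in the unit circle took one root to another, \<open>goldman \<tau>\<close>
  would be nonnegative; so it fixes every root.\<close>

lemma goldman_neg_roots:
  assumes "goldman \<tau> < 0"
  obtains k l m where "char_roots \<tau> k l m" "k \<noteq> l" "k \<noteq> m" "l \<noteq> m"
    "cmod k = 1" "cmod l = 1" "cmod m = 1"
proof -
  obtain k l m where r: "char_roots \<tau> k l m" using char_roots_exist by blast
  have u: "cmod k = 1" if r: "char_roots \<tau> k l m" for k l m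
    using char_roots_inverse_cnj[OF r] goldman_nonneg[OF r] goldman_nonneg[OF char_roots_permute(2)[OF r]]
      unit_if_inverse_cnj[of k] assms r by (fastforce simp: char_roots_def)
  show thesis
    using that[OF r] goldman_distinct[OF r] assms u[OF r] u[OF char_roots_permute(1)[OF r]]
      u[OF char_roots_permute(3)[OF r]] by simp
qed

text \<open>By \<open>goldman_nonpos\<close> some root lies off the unit circle, and its inverse in
  the circle is a second such root.\<close>

lemma goldman_pos_roots:
  assumes "goldman \<tau> > 0"
  obtains k l m where "char_roots \<tau> k l m" "k \<noteq> l" "k \<noteq> m" "l \<noteq> m" "cmod k \<noteq> 1" "cmod l \<noteq> 1"
proof -
  obtain k l m where "char_roots \<tau> k l m" using char_roots_exist by blast
  moreover from goldman_nonpos[OF this] assms have "cmod k \<noteq> 1 \<or> cmod l \<noteq> 1 \<or> cmod m \<noteq> 1" by force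
  ultimately obtain k l m where r: "char_roots \<tau> k l m" and k: "cmod k \<noteq> 1"
    using char_roots_permute by metis
  have w: "cmod l \<noteq> 1" if "1 / cnj k = l" for l
  proof -
    have "cmod l = 1 / cmod k" using that by (metis complex_mod_cnj norm_divide norm_one)
    then show ?thesis using k by auto
  qed
  have "k \<noteq> 0" using r by (auto simp: char_roots_def)
  with char_roots_inverse_cnj[OF r] unit_if_inverse_cnj[of k] k
  consider "1 / cnj k = l" | "1 / cnj k = m" by blast
  then show thesis
  proof cases
    case 1
    then show ?thesis using that[OF r] goldman_distinct[OF r] assms k w by simp
  next
    case 2
    have r': "char_roots \<tau> k m l" by (rule char_roots_permute(2)[OF r])
    show ?thesis using that[OF r'] goldman_distinct[OF r'] assms k w[OF 2] by simp
  qed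
qed

text \<open>The Lagrange basis polynomials at \<open>k\<close>, \<open>l\<close>, \<open>m\<close>
  sum to 1; \<open>a\<close>, \<open>b\<close>, \<open>c\<close> stand for the square of the
  variable, the variable and 1.\<close>

lemma lagrange_three:
  fixes k l m :: complex
  assumes "k \<noteq> l" "k \<noteq> m" "l \<noteq> m"
  shows "1 / ((k - l) * (k - m)) * (a - (l + m) * b + (l * m) * c)
    + 1 / ((l - k) * (l - m)) * (a - (k + m) * b + (k * m) * c)
    + 1 / ((m - k) * (m - l)) * (a - (k + l) * b + (k * l) * c) = c"
proof -
  define d where "d = 1 / ((k - l) * (k - m) * (l - m))"
  have d: "1 / ((k - l) * (k - m)) = (l - m) * d" "1 / ((l - k) * (l - m)) = - (k - m) * d"
    "1 / ((m - k) * (m - l)) = (k - l) * d" "d * ((k - l) * (k - m) * (l - m)) = 1"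
    using assms by (simp_all add: d_def divide_simps) (simp_all add: algebra_simps)
  have "(l - m) * d * (a - (l + m) * b + (l * m) * c) + - (k - m) * d * (a - (k + m) * b + (k * m) * c)
     + (k - l) * d * (a - (k + l) * b + (k * l) * c) = d * ((k - l) * (k - m) * (l - m)) * c"
    by (simp add: algebra_simps)
  then show ?thesis unfolding d by simp
qed

subsection \<open>The product of the three reflections\<close>

context unit_triple begin

text \<open>In coordinates relative to \<open>c1\<close>, \<open>c2\<close>, \<open>c3\<close> the
  reflections act through the Gram entries alone.\<close>

definition comb :: "complex \<Rightarrow> complex \<Rightarrow> complex \<Rightarrow> complex^3" where
  "comb x y z = x *s c1 + y *s c2 + z *s c3"

lemma comb_simps:
  "comb x y z + comb x' y' z' = comb (x + x') (y + y') (z + z')"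
  "comb x y z - comb x' y' z' = comb (x - x') (y - y') (z - z')"
  "w *s comb x y z = comb (w * x) (w * y) (w * z)"
  by (simp_all add: comb_def vec3_eq_iff algebra_simps)

lemma comb_reflections:
  "complex_reflection c1 (comb x y z) = comb (x + 2 * (y * g21 + z * g31)) (- y) (- z)"
  "complex_reflection c2 (comb x y z) = comb (- x) (y + 2 * (x * g12 + z * g32)) (- z)"
  "complex_reflection c3 (comb x y z) = comb (- x) (- y) (z + 2 * (x * g13 + y * g23))"
  by (simp_all add: comb_def complex_reflection_unit unit herm_simps vec3_eq_iff algebra_simps)

definition W :: "complex^3 \<Rightarrow> complex^3" where
  "W = complex_reflection c1 \<circ> complex_reflection c2 \<circ> complex_reflection c3"

text \<open>The inverse of \<open>W\<close>, since reflections are involutions.\<close>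

definition W' :: "complex^3 \<Rightarrow> complex^3" where
  "W' = complex_reflection c3 \<circ> complex_reflection c2 \<circ> complex_reflection c1"

text \<open>The trace of \<open>W\<close>.\<close>

definition \<tau> :: complex where
  "\<tau> = 3 - 4 * (g12 * g21 + g13 * g31 + g23 * g32) + 8 * (g21 * g13 * g32)"

lemma cnj_\<tau>: "cnj \<tau> = 3 - 4 * (g12 * g21 + g13 * g31 + g23 * g32) + 8 * (g12 * g31 * g23)"
  using herm_commute[of c2 c1] herm_commute[of c3 c1] herm_commute[of c3 c2]
  by (simp add: \<tau>_def mult.commute)

text \<open>The Cayley--Hamilton identity multiplied by the inverse of \<open>W\<close>, which keeps
  the words in the coordinate computation short.\<close>

lemma cayley_hamilton:
  "W (W (comb x y z)) - \<tau> *s W (comb x y z) + cnj \<tau> *s comb x y z - W' (comb x y z) = 0"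
proof -
  have z: "comb 0 0 0 = 0" by (simp add: comb_def)
  show ?thesis
    unfolding cnj_\<tau>
    unfolding W_def W'_def o_apply comb_reflections comb_simps z[symmetric] \<tau>_def
    by (rule arg_cong3[where f = comb]; simp add: algebra_simps)
qed

lemma linear_W: "clinear_map W"
  using clinear_complex_reflection by (simp add: clinear_map_def W_def)

lemma W_diff_scale: "W (u - v) = W u - W v" "W (u + v) = W u + W v" "W (a *s u) = a *s W u"
proof -
  show "W (u + v) = W u + W v" and s: "W (a *s u) = a *s W u" for u v a
    using linear_W by (auto simp: clinear_map_def)
  from this(1)[of u "- 1 *s v"] this(2)[of "- 1" v] show "W (u - v) = W u - W v"
    by (simp add: vector_sneg_minus1[symmetric])
qed

lemma isometry_W: "herm (W u) (W v) = herm u v"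
  by (simp add: W_def herm_complex_reflection unit)

lemma eigenvectors_orthogonal:
  assumes "W u = k *s u" "W v = l *s v" "k * cnj l \<noteq> 1"
  shows "herm u v = 0"
proof -
  have "k * cnj l * herm u v = herm u v"
    using isometry_W[of u v] unfolding assms(1,2) herm_simps by (simp only: mult_ac)
  then show ?thesis using assms(3) by simp
qed

text \<open>Lagrange interpolation at the three eigenvalues splits a vector into eigenvectors.\<close>

definition eigen_part :: "complex \<Rightarrow> complex \<Rightarrow> complex \<Rightarrow> complex^3 \<Rightarrow> complex^3" where
  "eigen_part k l m u = (1 / ((k - l) * (k - m))) *s (W (W u) - (l + m) *s W u + (l * m) *s u)"

text \<open>Applying \<open>W - k\<close> to \<open>(W - l)(W - m) u\<close> gives the
  characteristic polynomial of \<open>W\<close> at \<open>u\<close>, which is 0 by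
  Cayley--Hamilton.\<close>

lemma eigen_part_eigenvector:
  assumes r: "char_roots \<tau> k l m" and u: "u = comb x y z"
  shows "W (eigen_part k l m u) = k *s eigen_part k l m u"
proof -
  have "W (W u) - \<tau> *s W u + cnj \<tau> *s u - W' u = 0" unfolding u by (rule cayley_hamilton)
  then have "W (W u) - \<tau> *s W u + cnj \<tau> *s u = W' u" by simp
  then have "W (W (W u)) - \<tau> *s W (W u) + cnj \<tau> *s W u = W (W' u)"
    by (metis W_diff_scale)
  also have "W (W' u) = u" by (simp add: W_def W'_def complex_reflection_involution unit)
  finally have w: "W (W (W u)) = \<tau> *s W (W u) - cnj \<tau> *s W u + u"
    by (simp add: vec3_eq_iff algebra_simps)
  have \<tau>: "\<tau> = k + l + m" and \<tau>': "cnj \<tau> = k * l + k * m + l * m" and one: "k * l * m = 1"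
    using r by (auto simp: char_roots_def)
  define q where "q = W (W u) - (l + m) *s W u + (l * m) *s u"
  have "W q = W (W (W u)) - (l + m) *s W (W u) + (l * m) *s W u" by (simp add: q_def W_diff_scale)
  also have "\<dots> = (k + l + m) *s W (W u) - (k * l + k * m + l * m) *s W u + (k * l * m) *s u
      - (l + m) *s W (W u) + (l * m) *s W u"
    unfolding w one \<tau>' unfolding \<tau> by simp
  also have "\<dots> = k *s q" by (simp add: q_def vec3_eq_iff algebra_simps)
  finally show ?thesis
    unfolding eigen_part_def q_def[symmetric] by (simp add: W_diff_scale vec3_eq_iff)
qed

lemma eigen_part_sum:
  assumes "k \<noteq> l" "k \<noteq> m" "l \<noteq> m"
  shows "eigen_part k l m u + eigen_part l k m u + eigen_part m k l u = u"
  unfolding eigen_part_def vec3_eq_iff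
  by (simp only: vector_add_component vector_minus_component vector_smult_component
      lagrange_three[OF assms] simp_thms)

section \<open>Eigenvectors of negative norm and ellipticity of \<open>W_B\<close>\<close>

lemma negative_combination:
  obtains x y z where "Re (herm (comb x y z) (comb x y z)) < 0"
proof -
  \<comment> \<open>Norms \<alpha>, \<beta> and pairing \<zeta> of the projections of
    \<open>c1\<close>, \<open>c2\<close> to the complement of \<open>c3\<close>; their Gram
    determinant \<open>\<alpha> * \<beta> - Z\<close> is that of all three vectors.\<close>
  define \<alpha> where "\<alpha> = 1 - (cmod g13)\<^sup>2"
  define \<beta> where "\<beta> = 1 - (cmod g23)\<^sup>2"
  define \<zeta> where "\<zeta> = g12 - g13 * g32"
  define Z where "Z = (cmod \<zeta>)\<^sup>2"
  have c: "g21 = cnj g12" "g31 = cnj g13" "g32 = cnj g23"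
    using herm_commute[of c2 c1] herm_commute[of c3 c1] herm_commute[of c3 c2] by auto
  have "\<alpha> * \<beta> - Z = 1 - (cmod g12)\<^sup>2 - (cmod g13)\<^sup>2 - (cmod g23)\<^sup>2 + 2 * Re (g12 * g23 * g31)"
    unfolding \<alpha>_def \<beta>_def Z_def \<zeta>_def cmod_power2 c by (simp add: power2_eq_square algebra_simps)
  then have det: "\<alpha> * \<beta> < Z" using gram_negative by simp
  \<comment> \<open>\<open>w\<close> removes the component along \<open>c3\<close>, leaving the
    projection of \<open>c1\<close> plus a multiple of that of \<open>c2\<close>.\<close>
  have norm: "Re (herm (comb 1 (of_real r * \<zeta>) w) (comb 1 (of_real r * \<zeta>) w)) = \<alpha> + 2 * r * Z + r\<^sup>2 * Z * \<beta>"
    if w: "w = - g13 - of_real r * \<zeta> * g23" for r w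
  proof -
    have "herm (comb 1 (of_real r * \<zeta>) w) c3 = 0" by (simp add: comb_def w herm_simps unit)
    then have "herm (comb 1 (of_real r * \<zeta>) w) (comb 1 (of_real r * \<zeta>) w)
      = herm (comb 1 (of_real r * \<zeta>) w) (c1 + (of_real r * \<zeta>) *s c2)"
      by (simp add: comb_def herm_simps)
    also have "\<dots> = (1 - g13 * g31) + of_real r * (\<zeta> * cnj \<zeta>) + of_real r * (\<zeta> * cnj \<zeta>)
        + (of_real r)\<^sup>2 * (\<zeta> * cnj \<zeta>) * (1 - g23 * g32)"
      by (simp add: comb_def herm_simps unit w c \<zeta>_def power2_eq_square algebra_simps)
    also have "\<dots> = of_real (\<alpha> + 2 * r * Z + r\<^sup>2 * Z * \<beta>)"
      unfolding c complex_norm_square[symmetric] by (simp add: \<alpha>_def \<beta>_def Z_def)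
    finally show ?thesis by simp
  qed
  show thesis
  proof (cases "\<beta> < 0")
    case True
    have "herm (comb 0 1 (- g23)) (comb 0 1 (- g23)) = 1 - g23 * g32"
      by (simp add: comb_def herm_simps unit c algebra_simps)
    also have "\<dots> = of_real \<beta>" unfolding c complex_norm_square[symmetric] by (simp add: \<beta>_def)
    finally show ?thesis using True that[of 0 1 "- g23"] by simp
  next
    case False
    show ?thesis
    proof (cases "\<beta> = 0")
      case True
      then have "Z > 0" using det by simp
      \<comment> \<open>For \<open>\<beta> = 0\<close> the norm is linear in \<open>r\<close>; this
        \<open>r\<close> makes it -1.\<close>
      then have "\<alpha> + 2 * (- (\<alpha> + 1) / (2 * Z)) * Z + (- (\<alpha> + 1) / (2 * Z))\<^sup>2 * Z * \<beta> < 0"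
        using True by (simp add: field_simps)
      then show ?thesis using that norm[OF refl] by metis
    next
      case neq: False
      \<comment> \<open>The quadratic in \<open>r\<close> takes its minimum at
        \<open>- 1 / \<beta>\<close>.\<close>
      have "\<alpha> + 2 * (- 1 / \<beta>) * Z + (- 1 / \<beta>)\<^sup>2 * Z * \<beta> = (\<alpha> * \<beta> - Z) / \<beta>"
        using neq by (simp add: field_simps power2_eq_square)
      also have "\<dots> < 0" using False neq det by (simp add: divide_neg_pos)
      finally show ?thesis using that norm[OF refl] by metis
    qed
  qed
qed

text \<open>Distinct eigenvalues of modulus 1 have orthogonal eigenvectors, so the norm of a
  negative vector is the sum of the norms of its three eigenparts, one of which must be
  negative.\<close>

lemma elliptic_W_if_goldman_neg:
  assumes "goldman \<tau> < 0"
  shows "elliptic W"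
proof -
  obtain k l m where r: "char_roots \<tau> k l m" and ne: "k \<noteq> l" "k \<noteq> m" "l \<noteq> m"
    and u: "cmod k = 1" "cmod l = 1" "cmod m = 1" using goldman_neg_roots[OF assms] .
  obtain x y z where neg: "Re (herm (comb x y z) (comb x y z)) < 0" using negative_combination .
  define v where "v = comb x y z"
  define p where "p = eigen_part k l m v"
  define q where "q = eigen_part l k m v"
  define s where "s = eigen_part m k l v"
  have r2: "char_roots \<tau> l k m" "char_roots \<tau> m k l"
    using char_roots_permute(1)[OF r] char_roots_permute(2)[OF char_roots_permute(3)[OF r]]
      char_roots_permute(1)[OF char_roots_permute(2)[OF r]] by simp_all
  have e: "W p = k *s p" "W q = l *s q" "W s = m *s s"
    unfolding p_def q_def s_def
    by (rule eigen_part_eigenvector[OF r v_def] eigen_part_eigenvector[OF r2(1) v_def]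
        eigen_part_eigenvector[OF r2(2) v_def])+
  have c: "x * cnj y \<noteq> 1" if "cmod x = 1" "cmod y = 1" "x \<noteq> y" for x y
  proof
    assume "x * cnj y = 1"
    then have "x * (y * cnj y) = y" by (metis mult.commute mult.left_commute mult.right_neutral)
    moreover have "y * cnj y = 1" using complex_norm_square[of y] that by simp
    ultimately show False using that by simp
  qed
  have o: "herm p q = 0" "herm q p = 0" "herm p s = 0" "herm s p = 0" "herm q s = 0" "herm s q = 0"
    using eigenvectors_orthogonal[OF e(1,2)] eigenvectors_orthogonal[OF e(2,1)]
      eigenvectors_orthogonal[OF e(1,3)] eigenvectors_orthogonal[OF e(3,1)]
      eigenvectors_orthogonal[OF e(2,3)] eigenvectors_orthogonal[OF e(3,2)] c u ne by metis+
  have "v = p + q + s" unfolding p_def q_def s_def by (rule eigen_part_sum[OF ne, symmetric])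
  then have "herm v v = herm p p + herm q q + herm s s" by (simp add: herm_simps o)
  then have "Re (herm p p) < 0 \<or> Re (herm q q) < 0 \<or> Re (herm s s) < 0"
    using neg by (simp add: v_def) linarith
  moreover have "k \<noteq> 0" "l \<noteq> 0" "m \<noteq> 0" using u by auto
  ultimately show ?thesis unfolding elliptic_iff_eigenvector[OF linear_W] using e by blast
qed

text \<open>Otherwise two eigenvalues lie off the unit circle. Their eigenvectors would be
  orthogonal to a negative one, hence positive, which forces modulus 1; so these eigenparts vanish
  and \<open>c3\<close> is an eigenvector. But \<open>W c3\<close> has the coefficient
  \<open>- 2 * g32\<close> at \<open>c2\<close>.\<close>

lemma goldman_nonpos_if_elliptic_W:
  assumes "elliptic W" and g32: "g32 \<noteq> 0"
  shows "goldman \<tau> \<le> 0"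
proof (rule ccontr)
  assume "\<not> goldman \<tau> \<le> 0"
  then obtain k l m where r: "char_roots \<tau> k l m" and ne: "k \<noteq> l" "k \<noteq> m" "l \<noteq> m"
    and u: "cmod k \<noteq> 1" "cmod l \<noteq> 1" using goldman_pos_roots[of \<tau>] by auto
  obtain v z where v: "Re (herm v v) < 0" "W v = z *s v"
    using assms(1) unfolding elliptic_iff_eigenvector[OF linear_W] by blast
  have z: "cmod z = 1" using isometry_eigenvalue_norm[where g = W, OF isometry_W v(2)] v(1) by simp
  have zero: "p = 0" if p: "W p = x *s p" and x: "cmod x \<noteq> 1" for p x
  proof (rule ccontr)
    assume "p \<noteq> 0"
    have "x * cnj z \<noteq> 1" using x z by (metis complex_mod_cnj mult.right_neutral norm_mult norm_one)
    then have "herm p v = 0" by (rule eigenvectors_orthogonal[OF p v(2)])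
    then have "Re (herm p p) > 0" using positive_if_orthogonal_negative[OF v(1)] \<open>p \<noteq> 0\<close> by simp
    moreover from this have "cmod x = 1"
      using isometry_eigenvalue_norm[where g = W, OF isometry_W p] by simp
    ultimately show False using x by simp
  qed
  define w where "w = comb 0 0 1"
  have r2: "char_roots \<tau> l k m" "char_roots \<tau> m k l"
    using char_roots_permute(1)[OF r] char_roots_permute(1)[OF char_roots_permute(2)[OF r]] by simp_all
  have "eigen_part k l m w = 0" "eigen_part l k m w = 0"
    by (rule zero[OF eigen_part_eigenvector[OF r w_def] u(1)],
        rule zero[OF eigen_part_eigenvector[OF r2(1) w_def] u(2)])
  then have "eigen_part m k l w = w" using eigen_part_sum[OF ne, of w] by simp
  then have "W w = m *s w" using eigen_part_eigenvector[OF r2(2) w_def] by simp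
  moreover have "W w = comb (2 * (2 * g32 * g21 - g31)) (- (2 * g32)) 1"
    unfolding w_def W_def o_apply comb_reflections by (simp add: algebra_simps)
  ultimately have "comb (2 * (2 * g32 * g21 - g31)) (- (2 * g32)) (1 - m) = 0"
    unfolding w_def comb_simps
    by (simp add: comb_def vec3_eq_iff algebra_simps)
  from independent[OF this[unfolded comb_def]] g32 show False by simp
qed

end

subsection \<open>Triangles with given parameters\<close>

text \<open>Normalized triangles: for positive \<open>r1\<close>, \<open>r2\<close>,
  \<open>r3\<close> the last condition says that the argument of the triple product has cosine
  \<open>t\<close>.\<close>

definition realizes :: "real \<Rightarrow> real \<Rightarrow> real \<Rightarrow> real \<Rightarrow> (3 \<Rightarrow> complex^3) \<Rightarrow> bool" where
  "realizes r1 r2 r3 t d \<longleftrightarrow> (\<forall>k. herm (d k) (d k) = 1)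
    \<and> cmod (herm (d 3) (d 2)) = r1 \<and> cmod (herm (d 1) (d 3)) = r2 \<and> cmod (herm (d 2) (d 1)) = r3
    \<and> Re (herm (d 3) (d 2) * herm (d 1) (d 3) * herm (d 2) (d 1)) = r1 * r2 * r3 * t"

text \<open>Supplies the coefficient \<open>s\<close> in \<open>realizes_exists\<close>: the
  equation is linear for \<open>\<alpha> = 0\<close>, and otherwise quadratic with positive
  discriminant.\<close>

lemma quadratic_solvable:
  fixes \<alpha> \<beta> Z :: real
  assumes "\<alpha> \<ge> 0" "\<beta> \<ge> 0" "Z > \<alpha> * \<beta>"
  shows "\<exists>s. 2 * s * Z - \<alpha> * s\<^sup>2 * Z = \<beta>"
proof -
  have Z: "Z > 0" using mult_nonneg_nonneg[OF assms(1,2)] assms(3) by linarith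
  show ?thesis
  proof (cases "\<alpha> = 0")
    case True
    then show ?thesis using Z by (intro exI[of _ "\<beta> / (2 * Z)"]) simp
  next
    case False
    define q where "q = sqrt (1 - \<alpha> * \<beta> / Z)"
    have q: "q\<^sup>2 = 1 - \<alpha> * \<beta> / Z" using assms Z by (simp add: q_def)
    have "2 * ((1 - q) / \<alpha>) * Z - \<alpha> * ((1 - q) / \<alpha>)\<^sup>2 * Z = (1 - q\<^sup>2) * Z / \<alpha>"
      using False by (simp add: field_simps power2_eq_square)
    also have "\<dots> = \<beta>" unfolding q using False Z by simp
    finally show ?thesis by blast
  qed
qed

lemma realizes_exists:
  assumes r: "0 < r1" "r1 \<le> 1" "0 < r2" "r2 \<le> 1" "0 < r3" and t: "- 1 \<le> t" "t \<le> 1"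
    and gram: "1 - r1\<^sup>2 - r2\<^sup>2 - r3\<^sup>2 + 2 * r1 * r2 * r3 * t < 0"
  shows "\<exists>d. realizes r1 r2 r3 t d"
proof -
  \<comment> \<open>\<open>cnj w\<close> is to be the pairing of \<open>d 2\<close> with
    \<open>d 1\<close>; the other two pairings will be the positive reals \<open>r1\<close> and
    \<open>r2\<close>.\<close>
  define w where "w = of_real r3 * cis (arccos t)"
  define z where "z = w - of_real (r1 * r2)"
  define \<alpha> where "\<alpha> = 1 - r2\<^sup>2"
  define \<beta> where "\<beta> = 1 - r1\<^sup>2"
  have w: "Re w = r3 * t" "cmod w = r3" using t r by (simp_all add: w_def norm_mult)
  have "(cmod z)\<^sup>2 = (cmod w)\<^sup>2 - 2 * r1 * r2 * Re w + r1\<^sup>2 * r2\<^sup>2"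
    unfolding cmod_power2 by (simp add: z_def power2_eq_square algebra_simps)
  then have "(cmod z)\<^sup>2 > \<alpha> * \<beta>" using gram by (simp add: w \<alpha>_def \<beta>_def algebra_simps)
  moreover have "\<alpha> \<ge> 0" "\<beta> \<ge> 0" using r by (simp_all add: \<alpha>_def \<beta>_def power_le_one)
  ultimately obtain s where s: "2 * s * (cmod z)\<^sup>2 - \<alpha> * s\<^sup>2 * (cmod z)\<^sup>2 = \<beta>"
    using quadratic_solvable by blast
  \<comment> \<open>The sum \<open>x\<close> and half the difference \<open>y\<close> of the last
    two coordinates are isotropic coordinates, where the form is \<open>2 * Re (x * cnj y)\<close>.
    This choice meets the pairing with \<open>d 1\<close> for every \<open>s\<close>; the norm of
    \<open>d 2\<close> then fixes \<open>s\<close>.\<close>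
  define x where "x = of_real s * cnj z"
  define y where "y = of_real (1 - \<alpha> * s / 2) * cnj z"
  define d :: "3 \<Rightarrow> complex^3" where "d = (\<lambda>k.
    if k = 1 then vector [of_real r2, of_real ((1 + \<alpha>) / 2), of_real ((1 - \<alpha>) / 2)]
    else if k = 2 then vector [of_real r1, x / 2 + y, x / 2 - y]
    else vector [1, 0, 0])"
  have h11: "herm (d 1) (d 1) = 1"
    by (simp add: herm_def d_def complex_eq_iff) (simp add: \<alpha>_def power2_eq_square field_simps)
  have h33: "herm (d 3) (d 3) = 1" by (simp add: herm_def d_def)
  have "herm (d 2) (d 2) = of_real (r1 * r1) + x * cnj y + y * cnj x"
    by (simp add: herm_def d_def field_simps)
  also have "x * cnj y + y * cnj x = of_real (2 * s * (1 - \<alpha> * s / 2)) * (z * cnj z)"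
    by (simp add: x_def y_def)
  then have "of_real (r1 * r1) + x * cnj y + y * cnj x
      = of_real (r1\<^sup>2 + (2 * s * (cmod z)\<^sup>2 - \<alpha> * s\<^sup>2 * (cmod z)\<^sup>2))"
    unfolding complex_norm_square[symmetric] add.assoc by (simp add: power2_eq_square algebra_simps)
  also have "\<dots> = 1" unfolding s by (simp add: \<beta>_def)
  finally have h22: "herm (d 2) (d 2) = 1" .
  have h32: "herm (d 3) (d 2) = of_real r1" and h13: "herm (d 1) (d 3) = of_real r2"
    by (simp_all add: herm_def d_def)
  have "herm (d 2) (d 1) = of_real (r1 * r2) + of_real (\<alpha> / 2) * x + y"
    by (simp add: herm_def d_def field_simps)
  also have "\<dots> = cnj w" by (simp add: x_def y_def z_def field_simps)
  finally have h21: "herm (d 2) (d 1) = cnj w" .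
  have "realizes r1 r2 r3 t d"
    unfolding realizes_def forall_3 h11 h22 h33 h32 h13 h21 using r by (simp add: w)
  then show ?thesis by blast
qed

lemma realizes_herm:
  assumes "realizes r1 r2 r3 t d"
  shows "Re (herm (d 1) (d 2) * herm (d 2) (d 3) * herm (d 3) (d 1)) = r1 * r2 * r3 * t"
    and "cmod (herm (d 1) (d 2)) = r3" "cmod (herm (d 2) (d 3)) = r1" "cmod (herm (d 1) (d 3)) = r2"
proof -
  let ?p = "herm (d 1) (d 2) * herm (d 2) (d 3) * herm (d 3) (d 1)"
  have c: "herm (d 1) (d 2) = cnj (herm (d 2) (d 1))" "herm (d 2) (d 3) = cnj (herm (d 3) (d 2))"
    "herm (d 3) (d 1) = cnj (herm (d 1) (d 3))" by (rule herm_commute)+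
  have "?p = cnj (herm (d 3) (d 2) * herm (d 1) (d 3) * herm (d 2) (d 1))"
    unfolding c by simp
  then have "Re ?p = Re (herm (d 3) (d 2) * herm (d 1) (d 3) * herm (d 2) (d 1))"
    by (simp only: cnj.simps)
  then show "Re ?p = r1 * r2 * r3 * t" using assms by (simp add: realizes_def)
  show "cmod (herm (d 1) (d 2)) = r3" "cmod (herm (d 2) (d 3)) = r1" "cmod (herm (d 1) (d 3)) = r2"
    using assms unfolding c(1,2) by (simp_all add: realizes_def)
qed

lemma realizes_unit_triple:
  assumes "realizes r1 r2 r3 t d" and "1 - r1\<^sup>2 - r2\<^sup>2 - r3\<^sup>2 + 2 * r1 * r2 * r3 * t < 0"
  shows "unit_triple (d 1) (d 2) (d 3)"
  using realizes_herm[OF assms(1)] assms by unfold_locales (simp_all add: realizes_def)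

lemma elliptic_word_A_realizes:
  assumes d: "realizes r1 r2 r3 t d" and g: "1 - r1\<^sup>2 - r2\<^sup>2 - r3\<^sup>2 + 2 * r1 * r2 * r3 * t < 0"
  shows "elliptic (word_A d) \<longleftrightarrow> r3\<^sup>2 + 4 * r1\<^sup>2 * r2\<^sup>2 - 4 * r1 * r2 * r3 * t < 1"
proof -
  interpret unit_triple "d 1" "d 2" "d 3" by (rule realizes_unit_triple[OF d g])
  show ?thesis unfolding word_A_def elliptic_word_A_iff using realizes_herm[OF d]
    by (simp add: algebra_simps)
qed

text \<open>The discriminant of \<open>W_B\<close> as a function of \<open>x = 8 r\<^sub>1 r\<^sub>2 r\<^sub>3 t\<close>: here
  \<open>N\<close> is the squared modulus and \<open>x - D\<close> the real part of the trace.\<close>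

definition disc_B :: "real \<Rightarrow> real \<Rightarrow> real \<Rightarrow> real \<Rightarrow> real" where
  "disc_B a b c x = (let D = a + b + c - 3; y = x - D; N = D\<^sup>2 - 2 * D * x + a * b * c
     in N\<^sup>2 - 8 * (4 * y ^ 3 - 3 * y * N) + 18 * N - 27)"

text \<open>By the triple angle formula Goldman's function depends only on the real part and the
  modulus of the trace.\<close>

lemma goldman_shift:
  "goldman (of_real (- D) + w) = (let y = Re w - D; N = D\<^sup>2 - 2 * D * Re w + (cmod w)\<^sup>2
     in N\<^sup>2 - 8 * (4 * y ^ 3 - 3 * y * N) + 18 * N - 27)"
proof -
  define \<tau> where "\<tau> = of_real (- D) + w"
  define N where "N = D\<^sup>2 - 2 * D * Re w + (cmod w)\<^sup>2"
  have R: "Re \<tau> = Re w - D" by (simp add: \<tau>_def)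
  have N: "(cmod \<tau>)\<^sup>2 = N" unfolding N_def cmod_power2 by (simp add: \<tau>_def power2_eq_square algebra_simps)
  have "Re (\<tau> ^ 3) = 4 * (Re \<tau>) ^ 3 - 3 * Re \<tau> * (cmod \<tau>)\<^sup>2"
    unfolding cmod_power2 by (simp add: power2_eq_square power3_eq_cube algebra_simps)
  moreover have "(cmod \<tau>) ^ 4 = ((cmod \<tau>)\<^sup>2)\<^sup>2" by simp
  ultimately show ?thesis unfolding goldman_def \<tau>_def[symmetric] N R N_def[symmetric] Let_def by simp
qed

text \<open>The boundary value 0 is left undecided; later only strict signs are used.\<close>

lemma elliptic_word_B_realizes:
  assumes d: "realizes r1 r2 r3 t d" and g: "1 - r1\<^sup>2 - r2\<^sup>2 - r3\<^sup>2 + 2 * r1 * r2 * r3 * t < 0"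
    and r: "r1 > 0"
  shows "elliptic (word_B d) \<Longrightarrow> disc_B (4 * r1\<^sup>2) (4 * r2\<^sup>2) (4 * r3\<^sup>2) (8 * r1 * r2 * r3 * t) \<le> 0"
    and "disc_B (4 * r1\<^sup>2) (4 * r2\<^sup>2) (4 * r3\<^sup>2) (8 * r1 * r2 * r3 * t) < 0 \<Longrightarrow> elliptic (word_B d)"
proof -
  interpret unit_triple "d 1" "d 2" "d 3" by (rule realizes_unit_triple[OF d g])
  have wB: "word_B d = W" by (simp add: word_B_def W_def)
  define w where "w = 8 * (herm (d 3) (d 2) * herm (d 1) (d 3) * herm (d 2) (d 1))"
  have c: "herm (d 1) (d 2) = cnj (herm (d 2) (d 1))" "herm (d 2) (d 3) = cnj (herm (d 3) (d 2))"
    "herm (d 3) (d 1) = cnj (herm (d 1) (d 3))" by (rule herm_commute)+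
  have n: "cmod (herm (d 2) (d 1)) = r3" "cmod (herm (d 3) (d 2)) = r1" "cmod (herm (d 1) (d 3)) = r2"
    using d by (simp_all add: realizes_def)
  have s: "z * cnj z = of_real ((cmod z)\<^sup>2)" "cnj z * z = of_real ((cmod z)\<^sup>2)" for z
    using complex_norm_square[of z] by (simp_all add: mult.commute)
  have \<tau>: "\<tau> = of_real (- (4 * r1\<^sup>2 + 4 * r2\<^sup>2 + 4 * r3\<^sup>2 - 3)) + w"
    unfolding \<tau>_def c s n w_def by (simp add: algebra_simps)
  have Rw: "Re w = 8 * r1 * r2 * r3 * t" using d by (simp add: w_def realizes_def)
  have Nw: "(cmod w)\<^sup>2 = 4 * r1\<^sup>2 * (4 * r2\<^sup>2) * (4 * r3\<^sup>2)"
    by (simp add: w_def norm_mult n power_mult_distrib)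
  have G: "goldman \<tau> = disc_B (4 * r1\<^sup>2) (4 * r2\<^sup>2) (4 * r3\<^sup>2) (8 * r1 * r2 * r3 * t)"
    unfolding \<tau> goldman_shift disc_B_def Let_def Rw Nw ..
  have "herm (d 3) (d 2) \<noteq> 0" using n r by auto
  then show "elliptic (word_B d) \<Longrightarrow> disc_B (4 * r1\<^sup>2) (4 * r2\<^sup>2) (4 * r3\<^sup>2) (8 * r1 * r2 * r3 * t) \<le> 0"
    unfolding wB G[symmetric] by (intro goldman_nonpos_if_elliptic_W)
  show "disc_B (4 * r1\<^sup>2) (4 * r2\<^sup>2) (4 * r3\<^sup>2) (8 * r1 * r2 * r3 * t) < 0 \<Longrightarrow> elliptic (word_B d)"
    unfolding wB G[symmetric] by (intro elliptic_W_if_goldman_neg)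
qed

section \<open>Normalization of polar vectors and the angular invariant\<close>

lemma prod_index3: "prod f (UNIV :: 3 set) = f 1 * f 2 * f 3"
  unfolding UNIV_3 by (simp add: ac_simps)

lemma index3_simps:
  "(1::3) - 1 = 3" "(2::3) - 1 = 1" "(3::3) - 1 = 2" "(1::3) + 1 = 2" "(2::3) + 1 = 3" "(3::3) + 1 = 1"
  by simp_all

lemma angular_invariant_eq:
  "angular_invariant d = Arg (herm (d 3) (d 2) * herm (d 1) (d 3) * herm (d 2) (d 1)
    / (herm (d 1) (d 1) * herm (d 2) (d 2) * herm (d 3) (d 3)))"
  unfolding angular_invariant_def prod_index3 index3_simps ..

lemma cos_angular_invariant_unit:
  assumes "\<And>k. herm (d k) (d k) = 1"
    and "herm (d 3) (d 2) * herm (d 1) (d 3) * herm (d 2) (d 1) \<noteq> 0" (is "?p \<noteq> 0")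
  shows "cos (angular_invariant d) = Re ?p / cmod ?p"
  unfolding angular_invariant_eq assms(1) mult_1_right div_by_1 by (rule cos_Arg[OF assms(2)])

lemma angular_invariant_scale:
  assumes "\<And>k. z k > 0"
  shows "angular_invariant (\<lambda>k. of_real (z k) *s c k) = angular_invariant c"
proof -
  define P :: complex where "P = of_real ((z 1 * z 2 * z 3)\<^sup>2)"
  have "z k \<noteq> 0" for k using assms[of k] by simp
  then have P: "P \<noteq> 0" unfolding P_def of_real_eq_0_iff by simp
  have e: "of_real (z 2) * (of_real (z 3) * h1) * (of_real (z 3) * (of_real (z 1) * h2))
      * (of_real (z 1) * (of_real (z 2) * h3)) = P * (h1 * h2 * h3)"
    "of_real (z 1) * (of_real (z 1) * h1) * (of_real (z 2) * (of_real (z 2) * h2))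
      * (of_real (z 3) * (of_real (z 3) * h3)) = P * (h1 * h2 * h3)" for h1 h2 h3
    by (simp_all only: P_def of_real_mult power2_eq_square mult_ac)
  show ?thesis
    unfolding angular_invariant_eq herm_scale_left herm_scale_right complex_cnj_complex_of_real e
      nonzero_mult_divide_mult_cancel_left[OF P] ..
qed

text \<open>Normalizing polar vectors changes neither the words nor the angular invariant. Unit
  polar vectors of one geodesic differ by a factor of modulus 1, so the angles fix the moduli of the
  Gram entries.\<close>

lemma elliptic_at_iff_realizes:
  fixes n :: "3 \<Rightarrow> enat"
  defines "r \<equiv> \<lambda>k. cos (pi_over (n k))"
  assumes r: "\<And>k. r k > 0"
    and W: "\<And>c z. (\<And>k. z k \<noteq> 0) \<Longrightarrow> W (\<lambda>k. z k *s c k) = W c"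
  shows "elliptic_at n W t \<longleftrightarrow> (\<exists>d. realizes (r 1) (r 2) (r 3) t d \<and> elliptic (W d))"
proof
  assume "elliptic_at n W t"
  then obtain C c where tri: "is_triangle n C" and pol: "\<And>k. polar_vector (c k) (C k)"
    and t: "cos (angular_invariant c) = t" and ell: "elliptic (W c)"
    by (auto simp: elliptic_at_def)
  define z where "z k = 1 / sqrt (Re (herm (c k) (c k)))" for k
  define d where "d k = of_real (z k) *s c k" for k
  have z: "z k > 0" for k using pol[of k] by (simp add: z_def polar_vector_def)
  have u: "herm (d k) (d k) = 1" for k
  proof -
    have pos: "Re (herm (c k) (c k)) > 0" using pol[of k] by (simp add: polar_vector_def)
    have "(cmod (of_real (z k)))\<^sup>2 * Re (herm (c k) (c k)) = 1"
      using pos by (simp add: z_def norm_divide power_divide)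
    then have "Re (herm (d k) (d k)) = 1" unfolding d_def herm_self_scale .
    then show ?thesis using herm_self[of "d k"] by simp
  qed
  have m: "cmod (herm (d i) (d j)) = cos \<phi>" if "meet_at_angle (C i) (C j) \<phi>" for i j \<phi>
  proof -
    obtain e e' where e: "polar_vector e (C i)" "polar_vector e' (C j)" "herm e e = 1" "herm e' e' = 1"
      "cmod (herm e e') = cos \<phi>" using \<open>meet_at_angle (C i) (C j) \<phi>\<close> by (auto simp: meet_at_angle_def)
    have scale: "\<exists>y. d i = y *s e \<and> cmod y = 1" if e: "polar_vector e (C i)" "herm e e = 1" for e i
    proof -
      obtain y where y: "c i = y *s e"
        using e(1) pol[of i] by (metis polar_vector_def polar_vector_unique)
      then have dy: "d i = (of_real (z i) * y) *s e" by (simp add: d_def vec3_eq_iff)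
      then have "(cmod (of_real (z i) * y))\<^sup>2 = 1"
        using u[of i] herm_self_scale[of "of_real (z i) * y" e] e(2) by simp
      then have "cmod (of_real (z i) * y) = 1" by (simp only: abs_square_eq_1 abs_norm_cancel)
      with dy show ?thesis by blast
    qed
    from scale[OF e(1,3)] scale[OF e(2,4)] obtain y y' where
      "d i = y *s e" "cmod y = 1" "d j = y' *s e'" "cmod y' = 1" by blast
    then show ?thesis using e(5) by (simp add: herm_simps norm_mult)
  qed
  have "meet_at_angle (C (k - 1)) (C (k + 1)) (pi_over (n k))" for k
    using tri by (simp add: is_triangle_def)
  from m[OF this[of 1]] m[OF this[of 2]] m[OF this[of 3]]
  have n: "cmod (herm (d 3) (d 2)) = r 1" "cmod (herm (d 1) (d 3)) = r 2" "cmod (herm (d 2) (d 1)) = r 3"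
    unfolding index3_simps by (simp_all only: r_def)
  let ?p = "herm (d 3) (d 2) * herm (d 1) (d 3) * herm (d 2) (d 1)"
  have np: "cmod ?p = r 1 * r 2 * r 3" by (simp add: norm_mult n)
  moreover have pos: "r 1 * r 2 * r 3 > 0" using r by simp
  ultimately have "?p \<noteq> 0" by force
  from cos_angular_invariant_unit[OF u this] have "cos (angular_invariant d) = Re ?p / (r 1 * r 2 * r 3)"
    unfolding np .
  moreover have "angular_invariant d = angular_invariant c"
    using angular_invariant_scale[of z c] z by (simp add: d_def[abs_def])
  ultimately have "t = Re ?p / (r 1 * r 2 * r 3)" using t by (simp only:)
  then have "Re ?p = r 1 * r 2 * r 3 * t" using pos by (simp only: nonzero_mult_div_cancel_left times_divide_eq_right less_imp_neq[symmetric] not_False_eq_True)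
  then have "realizes (r 1) (r 2) (r 3) t d" unfolding realizes_def using u n by blast
  moreover have "W d = W c"
  proof -
    have "of_real (z k) \<noteq> (0 :: complex)" for k using z[of k] by simp
    then show ?thesis using W[of "\<lambda>k. of_real (z k)" c] by (simp add: d_def[abs_def])
  qed
  ultimately show "\<exists>d. realizes (r 1) (r 2) (r 3) t d \<and> elliptic (W d)" using ell by auto
next
  assume "\<exists>d. realizes (r 1) (r 2) (r 3) t d \<and> elliptic (W d)"
  then obtain d where d: "realizes (r 1) (r 2) (r 3) t d" and ell: "elliptic (W d)" by blast
  have u: "herm (d k) (d k) = 1" for k using d by (simp add: realizes_def)
  have pol: "polar_vector (d k) (complex_geodesic (d k))" for k by (simp add: polar_vector_def u)
  have n: "cmod (herm (d 3) (d 2)) = r 1" "cmod (herm (d 1) (d 3)) = r 2" "cmod (herm (d 2) (d 1)) = r 3"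
    using d by (simp_all add: realizes_def)
  have "\<forall>k. cmod (herm (d (k - 1)) (d (k + 1))) = r k" unfolding forall_3 index3_simps using n by simp
  then have "is_triangle n (\<lambda>k. complex_geodesic (d k))"
    unfolding is_triangle_def meet_at_angle_def r_def using pol u by blast
  moreover have "cos (angular_invariant d) = t"
  proof -
    let ?p = "herm (d 3) (d 2) * herm (d 1) (d 3) * herm (d 2) (d 1)"
    have np: "cmod ?p = r 1 * r 2 * r 3" by (simp add: norm_mult n)
    moreover have pos: "r 1 * r 2 * r 3 > 0" using r by simp
    ultimately have "?p \<noteq> 0" by force
    from cos_angular_invariant_unit[OF u this]
    have "cos (angular_invariant d) = Re ?p / (r 1 * r 2 * r 3)" unfolding np .
    moreover have "Re ?p = r 1 * r 2 * r 3 * t" using d unfolding realizes_def by blast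
    ultimately show ?thesis using pos by (metis nonzero_mult_div_cancel_left less_irrefl)
  qed
  ultimately show "elliptic_at n W t" unfolding elliptic_at_def using pol ell by blast
qed

subsection \<open>Monotonicity of the discriminant\<close>

text \<open>A quarter of the derivative of \<open>disc_B\<close>; a quadratic in \<open>x\<close>
  with leading coefficient -24.\<close>

definition slope_B :: "real \<Rightarrow> real \<Rightarrow> real \<Rightarrow> real \<Rightarrow> real" where
  "slope_B a b c x = (let D = a + b + c - 3
     in 6 * a * b * c - D * (D\<^sup>2 - 2 * D * x + a * b * c) - 6 * (2 * x - D)\<^sup>2 - 9 * D)"

lemma disc_B_has_derivative: "(disc_B a b c has_real_derivative 4 * slope_B a b c x) (at x)"
  unfolding disc_B_def[abs_def] slope_B_def Let_def
  by (auto intro!: derivative_eq_intros simp: power2_eq_square power3_eq_cube algebra_simps)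

text \<open>\<open>W_A\<close> is parabolic at \<open>x = (a b + c - 4) / 2\<close>.\<close>

lemma F_poly_eq_disc_B: "F_poly a b c = disc_B a b c ((a * b + c - 4) / 2)"
proof -
  define x where "x = (a * b + c - 4) / 2"
  have c: "c = 2 * x + 4 - a * b" by (simp add: x_def field_simps)
  show ?thesis unfolding x_def[symmetric] unfolding c F_poly_def disc_B_def Let_def
    by algebra
qed

text \<open>The following two sign statements are certified by writing the polynomial as a combination,
  with nonnegative coefficients, of products of the quantities assumed to be nonnegative. The
  coefficients were found by linear programming. The plane \<open>7 (a + b) = 4 c + 37\<close> separates the
  region where the slope at \<open>(a b + c - 4) / 2\<close> is nonnegative from the region where \<open>F_poly\<close> is
  nonnegative, apart from the common point \<open>a = b = c = 4\<close>.\<close>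

lemma F_poly_neg_near_ideal:
  assumes nonneg: "x \<ge> 0" "y \<ge> 0" "z \<ge> 0" and t0: "10 * x + 14 * y + 7 * z \<le> 3"
    and nz: "\<not> (x = 0 \<and> y = 0 \<and> z = 0)"
  shows "F_poly (4 - x - y - z) (4 - x - y) (4 - x) < 0"
proof -
  \<comment> \<open>With \<open>x = 4 - c\<close>, \<open>y = c - b\<close>,
    \<open>z = b - a\<close> this is \<open>7 (a + b) - 4 c - 37\<close>.\<close>
  define t where "t = 3 - 10 * x - 14 * y - 7 * z"
  have t: "t \<ge> 0" using t0 by (simp add: t_def)
  define R where "R = 5695 * x * y + 260 * x * z + 160 * y * z + 1000 * x ^ 3 + 100 * x ^ 2 * y
      + 2300 * x ^ 2 * z + 3300 * x * y ^ 2 + 3930 * x * y * z + 70 * x * z ^ 2 + 2368 * y ^ 3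
      + 24 * y ^ 2 * z + 1420 * y * z ^ 2 + 5000 * x ^ 4 + 27500 * x ^ 3 * y + 80000 * x ^ 3 * z
      + 24600 * x ^ 2 * y ^ 2 + 293300 * x ^ 2 * y * z + 48200 * x ^ 2 * z ^ 2 + 420 * x * y ^ 3
      + 340940 * x * y ^ 2 * z + 128835 * x * y * z ^ 2 + 110 * x * z ^ 3 + 808 * y ^ 4
      + 148848 * y ^ 3 * z + 90992 * y ^ 2 * z ^ 2 + 6180 * y * z ^ 3 + 2960 * z ^ 4
      + 50000 * x ^ 5 + 330000 * x ^ 4 * y + 9000 * x ^ 4 * z + 860000 * x ^ 3 * y ^ 2
      + 20000 * x ^ 3 * y * z + 60000 * x ^ 3 * z ^ 2 + 1082000 * x ^ 2 * y ^ 3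
      + 30000 * x ^ 2 * y ^ 2 * z + 160000 * x ^ 2 * y * z ^ 2 + 134000 * x ^ 2 * z ^ 3
      + 664800 * x * y ^ 4 + 140000 * x * y ^ 2 * z ^ 2 + 285000 * x * y * z ^ 3
      + 60000 * x * z ^ 4 + 170000 * y ^ 5 + 500 * y ^ 4 * z + 40000 * y ^ 3 * z ^ 2
      + 154000 * y ^ 2 * z ^ 3 + 60000 * y * z ^ 4 + 20000 * x ^ 5 * z + 128000 * x ^ 4 * y * z
      + 4000 * x ^ 4 * z ^ 2 + 240000 * x ^ 3 * y ^ 2 * z + 30000 * x ^ 3 * y * z ^ 2
      + 198000 * x ^ 2 * y ^ 3 * z + 10000 * x ^ 2 * y ^ 2 * z ^ 2 + 18000 * x ^ 2 * y * z ^ 3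
      + 4000 * x ^ 2 * z ^ 4 + 96200 * x * y ^ 4 * z + 600 * x * y ^ 3 * z ^ 2
      + 30000 * x * y ^ 2 * z ^ 3 + 15000 * x * y * z ^ 4 + 21000 * y ^ 5 * z
      + 500 * y ^ 4 * z ^ 2 + 8000 * y ^ 3 * z ^ 3 + 4000 * y ^ 2 * z ^ 4 + t * (9500 * x ^ 2
      + 45000 * x * y + 24000 * x * z + 48000 * y ^ 2 + 49500 * y * z + 21350 * x * z ^ 2
      + 26000 * y * z ^ 2 + 13280 * z ^ 3 + 5000 * x ^ 4 + 30000 * x ^ 3 * y
      + 60000 * x ^ 2 * y ^ 2 + 48200 * x * y ^ 3 + 15000 * y ^ 4 + 2000 * x ^ 4 * z
      + 10000 * x ^ 3 * y * z + 10000 * x ^ 2 * y ^ 2 * z + 2000 * x ^ 2 * z ^ 3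
      + 5800 * x * y ^ 3 * z + 5000 * x * y * z ^ 3 + 1500 * y ^ 4 * z + 2000 * y ^ 2 * z ^ 3)
      + t ^ 2 * (100 * x ^ 2 + 2145 * x * y + 860 * x * z + 1552 * y ^ 2 + 1260 * y * z)"
  have "- 10000 * F_poly (4 - x - y - z) (4 - x - y) (4 - x) = 600 * x ^ 2 + 2032 * y ^ 2 + 160 * z ^ 3 + R"
    unfolding R_def F_poly_def t_def by algebra
  moreover have "R \<ge> 0" unfolding R_def by (intro add_nonneg_nonneg mult_nonneg_nonneg zero_le_power nonneg t) auto
  \<comment> \<open>\<open>R\<close> is only bounded below by 0; strictness comes from the terms
    kept apart.\<close>
  moreover have "600 * x ^ 2 + 2032 * y ^ 2 + 160 * z ^ 3 > 0"
  proof -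
    have "600 * x ^ 2 \<ge> 0" "2032 * y ^ 2 \<ge> 0" "160 * z ^ 3 \<ge> 0" using nonneg by auto
    moreover have "600 * x ^ 2 > 0 \<or> 2032 * y ^ 2 > 0 \<or> 160 * z ^ 3 > 0" using nz nonneg by auto
    ultimately show ?thesis by linarith
  qed
  ultimately show ?thesis by linarith
qed

lemma slope_B_neg_at:
  assumes nonneg: "p \<ge> 0" "w \<ge> 0" "v \<ge> 0" and e0: "p + w + v \<le> 3"
    and t0: "7 * (2 * p + w) \<le> 27 + 4 * (p + w + v)"
  shows "slope_B (1 + p) (1 + p + w) (1 + p + w + v)
    (((1 + p) * (1 + p + w) + (1 + p + w + v) - 4) / 2) < 0" (is "?s < 0")
proof -
  \<comment> \<open>With \<open>p = a - 1\<close>, \<open>w = b - a\<close>,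
    \<open>v = c - b\<close> these are \<open>4 - c\<close> and
    \<open>4 c + 37 - 7 (a + b)\<close>.\<close>
  define e where "e = 3 - p - w - v"
  define t where "t = 27 + 4 * (p + w + v) - 7 * (2 * p + w)"
  have e: "e \<ge> 0" and t: "t \<ge> 0" using e0 t0 by (simp_all add: e_def t_def)
  define R where "R = 15 * p * w + 100 * p * v + 6 * w ^ 2 + 9500 * w * v + 36900 * v ^ 2 + 11 * p ^ 2 * w
      + 50 * p ^ 2 * v + 23 * p * w ^ 2 + 3095 * p * w * v + 14400 * p * v ^ 2 + 20148 * w ^ 3
      + 10198 * w ^ 2 * v + 10350 * w * v ^ 2 + 8 * p ^ 3 * w + 50 * p ^ 3 * v
      + 8 * p ^ 2 * w ^ 2 + 8638 * p ^ 2 * w * v + 450 * p ^ 2 * v ^ 2 + 70 * p * w ^ 3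
      + 20330 * p * w ^ 2 * v + 2000 * p * w * v ^ 2 + t * (2000 * v + 2000 * p * w
      + 4400 * p * v + 5900 * w ^ 2 + 3000 * w * v + 830 * p ^ 2 * w + 1400 * p ^ 2 * v
      + 820 * p * w ^ 2 + 2000 * p * w * v) + e * (6500 * v + 4195 * p * w + 98 * w ^ 2
      + 30000 * w * v + 1708 * p ^ 2 * w + 6050 * p ^ 2 * v + 17610 * p * w ^ 2
      + 10000 * p * w * v) + e * t * (2100 + 3000 * p) + e ^ 2 * (17650 * w)"
  define X where "X = ((1 + p) * (1 + p + w) + (1 + p + w + v) - 4) / 2"
  have X: "2 * X = (1 + p) * (1 + p + w) + (1 + p + w + v) - 4" by (simp add: X_def)
  have "- 10000 * ?s = 50 * w + 1300 * v + 3300 * e + R"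
    unfolding X_def[symmetric] unfolding R_def slope_B_def Let_def t_def e_def using X by algebra
  moreover have "R \<ge> 0" unfolding R_def
    by (intro add_nonneg_nonneg mult_nonneg_nonneg zero_le_power nonneg e t) auto
  moreover have "50 * w + 1300 * v + 3300 * e > 0"
  proof -
    \<comment> \<open>This restates \<open>t \<ge> 0\<close> and keeps \<open>e\<close>,
      \<open>w\<close>, \<open>v\<close> from vanishing together.\<close>
    have "10 * e + 7 * w + 14 * v \<ge> 3" using t unfolding e_def t_def by simp
    then show ?thesis using nonneg e by linarith
  qed
  ultimately show ?thesis by linarith
qed

text \<open>The slope is a concave quadratic in \<open>x\<close> whose vertex is not to the left of
  \<open>(a * b + c - 4) / 2\<close>, so it increases up to that point, where
  \<open>slope_B_neg_at\<close> applies.\<close>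

lemma slope_B_neg:
  assumes "1 \<le> a" "a \<le> b" "b \<le> c" "c \<le> 4" and s: "7 * (a + b) \<le> 4 * c + 37"
    and x: "x \<le> (a * b + c - 4) / 2"
  shows "slope_B a b c x < 0"
proof -
  define p where "p = a - 1"
  define q where "q = b - 1"
  define D where "D = a + b + c - 3"
  define x0 where "x0 = (a * b + c - 4) / 2"
  have pq: "0 \<le> p" "p \<le> q" "q \<le> c - 1" using assms by (simp_all add: p_def q_def)
  have "slope_B a b c x0 < 0"
    using slope_B_neg_at[of "a - 1" "b - a" "c - b"] assms by (simp add: x0_def)
  moreover have "slope_B a b c x \<le> slope_B a b c x0"
  proof -
    have "p * q \<le> 8"
    proof -
      have "4 * (p * q) \<le> (p + q)\<^sup>2"
        using zero_le_power2[of "p - q"] by (simp add: power2_eq_square algebra_simps)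
      \<comment> \<open>The plane inequality with \<open>c \<le> 4\<close> gives
        \<open>a + b \<le> 53 / 7\<close>, hence \<open>p + q \<le> 39 / 7\<close>.\<close>
      also have "\<dots> \<le> (39 / 7)\<^sup>2" using pq s assms by (intro power_mono) (auto simp: p_def q_def)
      finally show ?thesis by (simp add: power2_eq_square)
    qed
    moreover have "9 * (p * q) \<le> D\<^sup>2"
    proof -
      have "9 * (p * q) \<le> (p + 2 * q)\<^sup>2"
      proof -
        have "0 \<le> (q - p) * (4 * q - p)" using pq by (intro mult_nonneg_nonneg) auto
        then show ?thesis by (simp add: power2_eq_square algebra_simps)
      qed
      also have "\<dots> \<le> D\<^sup>2" using pq by (intro power_mono) (auto simp: D_def p_def q_def)
      finally show ?thesis .
    qed
    moreover have "2 * x0 = D + p * q - 2"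
      by (simp add: x0_def D_def p_def q_def field_simps)
    \<comment> \<open>Here \<open>24 * p * q\<close> splits as
      \<open>18 * p * q + 6 * p * q\<close>, at most \<open>2 * D^2 + 48\<close>; this places
      \<open>x0\<close> before the vertex.\<close>
    ultimately have "24 * (2 * x0) \<le> 2 * D\<^sup>2 + 24 * D" by linarith
    moreover have "24 * (x0 + x) \<le> 24 * (2 * x0)" using x unfolding x0_def[symmetric] by simp
    ultimately have "0 \<le> (x0 - x) * (2 * D\<^sup>2 + 24 * D - 24 * (x0 + x))"
      using x unfolding x0_def[symmetric] by (intro mult_nonneg_nonneg) auto
    also have "\<dots> = slope_B a b c x0 - slope_B a b c x"
      unfolding slope_B_def Let_def D_def[symmetric] by (simp add: power2_eq_square algebra_simps)
    finally show ?thesis by simp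
  qed
  ultimately show ?thesis by simp
qed

text \<open>A positive \<open>F_poly\<close> excludes the region near (4,4,4), so the discriminant
  decreases towards its value \<open>F_poly a b c\<close> at the threshold of
  \<open>W_A\<close>.\<close>

lemma disc_B_pos_before:
  assumes abc: "1 \<le> a" "a \<le> b" "b \<le> c" "c \<le> 4" and F: "F_poly a b c > 0"
    and x: "x \<le> (a * b + c - 4) / 2"
  shows "disc_B a b c x > 0"
proof -
  define x0 where "x0 = (a * b + c - 4) / 2"
  have "F_poly 4 4 4 = 0" by (simp add: F_poly_def)
  have s: "7 * (a + b) \<le> 4 * c + 37"
  proof (rule ccontr)
    assume "\<not> ?thesis"
    with abc have "F_poly a b c < 0 \<or> a = 4 \<and> b = 4 \<and> c = 4"
      using F_poly_neg_near_ideal[of "4 - c" "c - b" "b - a"] by (auto simp: algebra_simps)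
    with F \<open>F_poly 4 4 4 = 0\<close> show False by auto
  qed
  have "disc_B a b c x0 \<le> disc_B a b c x"
  proof (rule DERIV_nonpos_imp_nonincreasing[where f = "disc_B a b c"])
    show "x \<le> x0" using x by (simp add: x0_def)
    fix y assume "x \<le> y" "y \<le> x0"
    then have "slope_B a b c y < 0" using slope_B_neg[OF abc s] by (simp add: x0_def)
    then show "\<exists>d. (disc_B a b c has_real_derivative d) (at y) \<and> d \<le> 0"
      using disc_B_has_derivative[of a b c y] by (intro exI conjI) auto
  qed
  then show ?thesis using F unfolding F_poly_eq_disc_B x0_def[symmetric] by simp
qed

text \<open>On one side of the plane the negative slope also covers \<open>F_poly a b c = 0\<close>;
  on the other side \<open>F_poly\<close> is already negative and the threshold itself
  serves.\<close>

lemma disc_B_neg_after: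
  assumes abc: "1 \<le> a" "a \<le> b" "b \<le> c" "c \<le> 4" and F: "F_poly a b c \<le> 0"
    and ne: "\<not> (a = 4 \<and> b = 4 \<and> c = 4)" and u: "(a * b + c - 4) / 2 < u"
  obtains x where "(a * b + c - 4) / 2 \<le> x" "x < u" "disc_B a b c x < 0"
proof -
  define x0 where "x0 = (a * b + c - 4) / 2"
  have F': "disc_B a b c x0 \<le> 0" using F unfolding F_poly_eq_disc_B x0_def .
  show thesis
  proof (cases "7 * (a + b) \<le> 4 * c + 37")
    case True
    have "slope_B a b c x0 < 0" by (rule slope_B_neg[OF abc True]) (simp add: x0_def)
    then have "4 * slope_B a b c x0 < 0" by simp
    from DERIV_neg_dec_right[OF disc_B_has_derivative this] obtain d
      where d: "d > 0" "\<And>h. 0 < h \<Longrightarrow> h < d \<Longrightarrow> disc_B a b c (x0 + h) < disc_B a b c x0" by blast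
    define h where "h = min d (u - x0) / 2"
    have "u - x0 > 0" using u by (simp add: x0_def)
    then have h: "h > 0" "h \<le> d / 2" "h \<le> (u - x0) / 2" using d(1) by (simp_all add: h_def)
    have "h < d" using h d(1) by linarith
    moreover have "x0 + h < u" using h(3) \<open>u - x0 > 0\<close> by (simp add: field_simps)
    ultimately show ?thesis using that[of "x0 + h"] d(2)[OF h(1)] h(1) F' by (simp add: x0_def)
  next
    case False
    with abc ne have "F_poly a b c < 0"
      using F_poly_neg_near_ideal[of "4 - c" "c - b" "b - a"] by (auto simp: algebra_simps)
    then show ?thesis using that[of x0] u unfolding F_poly_eq_disc_B x0_def by simp
  qed
qed

subsection \<open>Types of triples\<close>

lemma pi_over_bounds:
  assumes "3 \<le> m" shows "0 \<le> pi_over m" "pi_over m \<le> pi / 3"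
proof -
  have "0 \<le> pi_over m \<and> pi_over m \<le> pi / 3"
  proof (cases m)
    case (enat k)
    then have "k \<ge> 3" using assms by (simp add: numeral_eq_enat)
    then have "pi / real k \<le> pi / 3" by (intro divide_left_mono) auto
    moreover have "0 \<le> pi / real k" by simp
    moreover have "pi_over m = pi / real k" by (simp add: enat pi_over_def)
    ultimately show ?thesis by (simp only:)
  qed (simp add: pi_over_def)
  then show "0 \<le> pi_over m" "pi_over m \<le> pi / 3" by auto
qed

lemma pi_over_antimono:
  assumes "3 \<le> m" "m \<le> m'" shows "pi_over m' \<le> pi_over m"
proof (cases m')
  case (enat k')
  then obtain k where k: "m = enat k" using assms(2) by (cases m) auto
  have "3 \<le> k" "k \<le> k'" using assms enat k by (simp_all add: numeral_eq_enat)
  then show ?thesis using enat k by (simp add: pi_over_def frac_le)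
next
  case infinity
  then show ?thesis using pi_over_bounds(1)[OF assms(1)] by (simp add: pi_over_def)
qed

lemma cos_pi_over:
  assumes "3 \<le> m"
  shows "1 / 2 \<le> cos (pi_over m)" "m \<le> m' \<Longrightarrow> cos (pi_over m) \<le> cos (pi_over m')"
proof -
  have b: "0 \<le> pi_over m" "pi_over m \<le> pi / 3" by (rule pi_over_bounds[OF assms])+
  then have "cos (pi / 3) \<le> cos (pi_over m)" by (intro cos_monotone_0_pi_le) auto
  then show "1 / 2 \<le> cos (pi_over m)" by (simp add: cos_60)
  assume m: "m \<le> m'"
  then have "0 \<le> pi_over m'" using pi_over_bounds(1) assms by (meson order_trans)
  moreover have "pi_over m \<le> pi" using b by simp
  ultimately show "cos (pi_over m) \<le> cos (pi_over m')"
    using pi_over_antimono[OF assms m] by (intro cos_monotone_0_pi_le)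
qed

lemma word_A_scale: "(\<And>k. z k \<noteq> 0) \<Longrightarrow> word_A (\<lambda>k. z k *s c k) = word_A c"
  and word_B_scale: "(\<And>k. z k \<noteq> 0) \<Longrightarrow> word_B (\<lambda>k. z k *s c k) = word_B c"
  by (simp_all add: word_A_def word_B_def complex_reflection_scale)

text \<open>The parameter at which \<open>W_A\<close> becomes elliptic lies inside the deformation space, except
  for the triples (3,3,3) and (\<open>\<infinity>\<close>,\<open>\<infinity>\<close>,\<open>\<infinity>\<close>).\<close>

lemma parabolic_parameter_bounds:
  fixes r1 r2 r3 :: real
  assumes r: "1 / 2 \<le> r1" "r1 \<le> r2" "r2 \<le> r3" "r3 \<le> 1"
    and ne: "\<not> (r1 = 1 / 2 \<and> r2 = 1 / 2 \<and> r3 = 1 / 2)" "\<not> (r1 = 1 \<and> r2 = 1 \<and> r3 = 1)"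
  defines "x \<equiv> 2 * r3\<^sup>2 + 8 * r1\<^sup>2 * r2\<^sup>2 - 2"
  shows "- (8 * r1 * r2 * r3) < x" "x < 8 * r1 * r2 * r3" "x < 4 * (r1\<^sup>2 + r2\<^sup>2 + r3\<^sup>2 - 1)"
proof -
  \<comment> \<open>The first two bounds amount to \<open>(r3 + 2 r1 r2)^2 > 1\<close> and
    \<open>(2 r1 r2 - r3)^2 < 1\<close>.\<close>
  have lower: "1 / 2 * r2 \<le> r1 * r2" using r by (intro mult_right_mono) auto
  have upper: "r1 * r2 \<le> r1 * 1" using r by (intro mult_left_mono) auto
  have "r2 + r3 > 1"
  proof (rule ccontr)
    assume "\<not> r2 + r3 > 1"
    then have "r2 = 1 / 2" "r3 = 1 / 2" using r by auto
    with r ne(1) show False by simp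
  qed
  then have s1: "r3 + 2 * (r1 * r2) > 1" using lower by simp
  have "r1 < 1"
  proof (rule ccontr)
    assume "\<not> r1 < 1"
    then have "r1 = 1" "r2 = 1" "r3 = 1" using r by auto
    with ne(2) show False by simp
  qed
  then have "2 * (r1 * r2) - r3 < 1" using upper r by linarith
  moreover have "r3 - 2 * (r1 * r2) < 1" using lower r by linarith
  ultimately have s2: "\<bar>2 * (r1 * r2) - r3\<bar> < 1" unfolding abs_less_iff by linarith
  have "(r3 + 2 * (r1 * r2))\<^sup>2 > 1" using s1 by (simp add: power2_eq_square less_1_mult)
  then show "- (8 * r1 * r2 * r3) < x" by (simp add: x_def power2_eq_square algebra_simps)
  have "(2 * (r1 * r2) - r3)\<^sup>2 < 1" using s2 by (simp add: abs_square_less_1)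
  then show "x < 8 * r1 * r2 * r3" by (simp add: x_def power2_eq_square algebra_simps)
  define a where "a = 4 * r1\<^sup>2"
  define b where "b = 4 * r2\<^sup>2"
  define c where "c = 4 * r3\<^sup>2"
  have abc: "1 \<le> a" "a \<le> b" "b \<le> c" "c \<le> 4"
    using r power_mono[of "1 / 2" r1 2] power_mono[of r1 r2 2] power_mono[of r2 r3 2] power_mono[of r3 1 2]
    by (simp_all add: a_def b_def c_def power2_eq_square)
  have root: "4 * y\<^sup>2 = 1 \<Longrightarrow> y = 1 / 2" "4 * y\<^sup>2 = 4 \<Longrightarrow> y = 1" if "y > 0" for y :: real
    using that abs_square_eq_1[of "2 * y"] abs_square_eq_1[of y] by (simp_all add: power_mult_distrib)
  have pos: "r1 > 0" "r2 > 0" "r3 > 0" using r by auto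
  have ne': "\<not> (a = 1 \<and> b = 1 \<and> c = 1)" "\<not> (a = 4 \<and> b = 4 \<and> c = 4)"
    using ne root pos unfolding a_def b_def c_def by blast+
  \<comment> \<open>The third bound, \<open>(a b + c - 4) / 2 < a + b + c - 4\<close>,
    rearranged.\<close>
  have "(a - 2) * (b - 2) < c"
  proof (rule ccontr)
    assume "\<not> (a - 2) * (b - 2) < c"
    then have ge: "(a - 2) * (b - 2) \<ge> c" by simp
    consider "a \<le> 2" "b \<le> 2" | "a \<le> 2" "b > 2" | "a > 2" by linarith
    then show False
    proof cases
      case 1
      have "(2 - a) * (2 - b) \<le> (2 - a) * 1" using 1 abc by (intro mult_left_mono) auto
      also have "(2 - a) * (2 - b) = (a - 2) * (b - 2)" by (simp add: algebra_simps)
      finally have "c + a \<le> 2" using ge by simp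
      then have "a = 1 \<and> b = 1 \<and> c = 1" using abc by auto
      then show False using ne' by blast
    next
      case 2
      then have "(a - 2) * (b - 2) \<le> 0" by (intro mult_nonpos_nonneg) auto
      then show False using abc ge by linarith
    next
      case 3
      have "(a - 2) * (b - 2) \<le> 2 * (b - 2)" using 3 abc by (intro mult_right_mono) auto
      then have "b = 4 \<and> c = 4" using ge abc by auto
      moreover from this have "a = 4" using ge abc by auto
      ultimately show False using ne' by blast
    qed
  qed
  then show "x < 4 * (r1\<^sup>2 + r2\<^sup>2 + r3\<^sup>2 - 1)"
    by (simp add: x_def a_def b_def c_def algebra_simps)
qed

theorem theorem1p1:
  fixes n :: "3 \<Rightarrow> enat" and a b c :: real
  assumes "3 \<le> n 1" and "n 1 \<le> n 2" and "n 2 \<le> n 3"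
    and "a = 4 * (cos (pi_over (n 1)))\<^sup>2"
    and "b = 4 * (cos (pi_over (n 2)))\<^sup>2"
    and "c = 4 * (cos (pi_over (n 3)))\<^sup>2"
  shows "type_A n \<longleftrightarrow> F_poly a b c > 0"
proof -
  define r1 where "r1 = cos (pi_over (n 1))"
  define r2 where "r2 = cos (pi_over (n 2))"
  define r3 where "r3 = cos (pi_over (n 3))"
  have a: "a = 4 * r1\<^sup>2" and b: "b = 4 * r2\<^sup>2" and c: "c = 4 * r3\<^sup>2"
    using assms by (simp_all add: r1_def r2_def r3_def)
  have n3: "3 \<le> n 2" "3 \<le> n 3" using assms by (meson order_trans)+
  have r: "1 / 2 \<le> r1" "r1 \<le> r2" "r2 \<le> r3" "r3 \<le> 1"
    unfolding r1_def r2_def r3_def using cos_pi_over assms n3 by auto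
  have pos: "r1 > 0" "r2 > 0" "r3 > 0" and le: "r1 \<le> 1" "r2 \<le> 1" using r by auto
  have rk: "cos (pi_over (n k)) > 0" for k
    using exhaust_3[of k] pos unfolding r1_def r2_def r3_def by auto
  define K where "K = 8 * r1 * r2 * r3"
  have K: "K > 0" using pos by (simp add: K_def)
  define tu where "tu = t_upper n"
  have tu: "tu = min (4 * (r1\<^sup>2 + r2\<^sup>2 + r3\<^sup>2 - 1) / K) 1"
  proof -
    have "4 * (r1\<^sup>2 + r2\<^sup>2 + r3\<^sup>2 - 1) / K = (r1\<^sup>2 + r2\<^sup>2 + r3\<^sup>2 - 1) / (2 * r1 * r2 * r3)"
      using pos by (simp add: K_def field_simps)
    then show ?thesis by (simp add: tu_def t_upper_def Let_def flip: r1_def r2_def r3_def)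
  qed
  have less_tu: "t < tu \<longleftrightarrow> K * t < 4 * (r1\<^sup>2 + r2\<^sup>2 + r3\<^sup>2 - 1) \<and> K * t < K" for t
    using K by (simp add: tu field_simps)
  have gram: "1 - r1\<^sup>2 - r2\<^sup>2 - r3\<^sup>2 + 2 * r1 * r2 * r3 * t < 0" if "t < tu" for t
    using that unfolding less_tu K_def by simp
  have ex: "\<exists>d. realizes r1 r2 r3 t d" if "- 1 \<le> t" "t < tu" for t
    using that r gram[OF that(2)] pos le by (intro realizes_exists) (auto simp: tu)
  define xA where "xA = (a * b + c - 4) / 2"
  have xA: "xA = 2 * r3\<^sup>2 + 8 * r1\<^sup>2 * r2\<^sup>2 - 2" by (simp add: xA_def a b c)
  have A: "elliptic_at n word_A t \<longleftrightarrow> xA < K * t" if "- 1 \<le> t" "t < tu" for t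
  proof -
    have "elliptic_at n word_A t \<longleftrightarrow> (\<exists>d. realizes r1 r2 r3 t d \<and> elliptic (word_A d))"
      unfolding r1_def r2_def r3_def by (rule elliptic_at_iff_realizes[OF rk word_A_scale])
    also have "\<dots> \<longleftrightarrow> r3\<^sup>2 + 4 * r1\<^sup>2 * r2\<^sup>2 - 4 * r1 * r2 * r3 * t < 1"
      using ex[OF that] elliptic_word_A_realizes[OF _ gram[OF that(2)]] by blast
    finally show ?thesis by (auto simp: xA K_def)
  qed
  have B: "elliptic_at n word_B t \<Longrightarrow> disc_B a b c (K * t) \<le> 0"
    "disc_B a b c (K * t) < 0 \<Longrightarrow> elliptic_at n word_B t" if "- 1 \<le> t" "t < tu" for t
  proof -
    have e: "elliptic_at n word_B t \<longleftrightarrow> (\<exists>d. realizes r1 r2 r3 t d \<and> elliptic (word_B d))"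
      unfolding r1_def r2_def r3_def by (rule elliptic_at_iff_realizes[OF rk word_B_scale])
    show "elliptic_at n word_B t \<Longrightarrow> disc_B a b c (K * t) \<le> 0"
      unfolding e K_def a b c using elliptic_word_B_realizes(1)[OF _ gram[OF that(2)] pos(1)] by blast
    show "disc_B a b c (K * t) < 0 \<Longrightarrow> elliptic_at n word_B t"
      unfolding e K_def a b c
      using ex[OF that] elliptic_word_B_realizes(2)[OF _ gram[OF that(2)] pos(1)] by blast
  qed
  have abc: "1 \<le> a" "a \<le> b" "b \<le> c" "c \<le> 4"
    using r power_mono[of "1 / 2" r1 2] power_mono[of r1 r2 2] power_mono[of r2 r3 2] power_mono[of r3 1 2]
    by (simp_all add: a b c power2_eq_square)
  have type: "type_A n \<longleftrightarrow> (\<exists>t. - 1 \<le> t \<and> t < tu \<and> xA < K * t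
      \<and> (\<forall>s. - 1 \<le> s \<and> s \<le> t \<longrightarrow> \<not> elliptic_at n word_B s))"
  proof
    assume "type_A n"
    then obtain t where t: "- 1 \<le> t" "t < tu" and tA: "elliptic_at n word_A t"
      and tB: "\<And>s. - 1 \<le> s \<Longrightarrow> s < tu \<Longrightarrow> s \<le> t \<Longrightarrow> \<not> elliptic_at n word_B s"
      unfolding type_A_def deformation_space_def tu_def[symmetric] by auto
    have "xA < K * t" using A[OF t] tA by blast
    moreover have "\<not> elliptic_at n word_B s" if "- 1 \<le> s" "s \<le> t" for s
      using tB[of s] that t(2) by linarith
    ultimately show "\<exists>t. - 1 \<le> t \<and> t < tu \<and> xA < K * t
      \<and> (\<forall>s. - 1 \<le> s \<and> s \<le> t \<longrightarrow> \<not> elliptic_at n word_B s)" using t by blast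
  next
    assume "\<exists>t. - 1 \<le> t \<and> t < tu \<and> xA < K * t
      \<and> (\<forall>s. - 1 \<le> s \<and> s \<le> t \<longrightarrow> \<not> elliptic_at n word_B s)"
    then obtain t where t: "- 1 \<le> t" "t < tu" "xA < K * t"
      and tB: "\<And>s. - 1 \<le> s \<Longrightarrow> s \<le> t \<Longrightarrow> \<not> elliptic_at n word_B s" by blast
    then show "type_A n" using A[OF t(1,2)]
      unfolding type_A_def deformation_space_def tu_def[symmetric] by (intro bexI[of _ t]) auto
  qed
  show ?thesis
  proof (cases "(r1 = 1 / 2 \<and> r2 = 1 / 2 \<and> r3 = 1 / 2) \<or> (r1 = 1 \<and> r2 = 1 \<and> r3 = 1)")
    case True
    then have "F_poly a b c = 0"
    proof (elim disjE conjE)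
      assume h: "r1 = 1 / 2" "r2 = 1 / 2" "r3 = 1 / 2"
      show ?thesis unfolding a b c h by (simp add: F_poly_def power_one_over)
    qed (simp add: a b c F_poly_def)
    moreover have "\<not> type_A n" unfolding type less_tu
    proof clarify
      fix t assume t: "- 1 \<le> t" "xA < K * t" "K * t < 4 * (r1\<^sup>2 + r2\<^sup>2 + r3\<^sup>2 - 1)" "K * t < K"
      from True show False
      proof
        assume "r1 = 1 / 2 \<and> r2 = 1 / 2 \<and> r3 = 1 / 2"
        then have h: "r1 = 1 / 2" "r2 = 1 / 2" "r3 = 1 / 2" by blast+
        from t(1,3) show False unfolding K_def h by (simp add: power_one_over)
      next
        assume "r1 = 1 \<and> r2 = 1 \<and> r3 = 1"
        then show False using t by (simp add: K_def xA)
      qed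
    qed
    ultimately show ?thesis by simp
  next
    case False
    then have ne: "\<not> (r1 = 1 / 2 \<and> r2 = 1 / 2 \<and> r3 = 1 / 2)" "\<not> (r1 = 1 \<and> r2 = 1 \<and> r3 = 1)" by auto
    have bd: "- K < xA" "xA < K" "xA < 4 * (r1\<^sup>2 + r2\<^sup>2 + r3\<^sup>2 - 1)"
      unfolding xA K_def by (rule parabolic_parameter_bounds[OF r ne])+
    have tK: "- 1 \<le> y / K" if "xA \<le> y" for y using that bd K by (simp add: field_simps)
    show ?thesis
    proof
      assume F: "F_poly a b c > 0"
      \<comment> \<open>\<open>W_A\<close> is elliptic only strictly beyond \<open>xA\<close>, so
        positivity has to be carried past \<open>xA\<close> by continuity.\<close>
      have "disc_B a b c xA > 0" using F by (simp add: F_poly_eq_disc_B xA_def)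
      moreover have "isCont (disc_B a b c) xA" using disc_B_has_derivative DERIV_isCont by blast
      ultimately have "eventually (\<lambda>x. disc_B a b c x > 0) (at xA)"
        by (intro order_tendstoD(1)[of _ "disc_B a b c xA"]) (auto simp: isCont_def)
      then obtain e where e: "e > 0" "\<And>x. x \<noteq> xA \<Longrightarrow> dist x xA < e \<Longrightarrow> disc_B a b c x > 0"
        unfolding eventually_at by auto
      \<comment> \<open>Beyond \<open>xA\<close>, but within the neighbourhood and the deformation
        space.\<close>
      define x where "x = min (xA + e / 2) ((xA + K * tu) / 2)"
      have "xA / K < tu" using bd K by (simp add: less_tu)
      then have "xA < K * tu" using K by (simp add: pos_divide_less_eq mult.commute)
      then have x: "xA < x" "x < xA + e" "x < K * tu" using e(1) unfolding x_def min_def by auto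
      have xK: "K * (x / K) = x" using K by simp
      have "\<not> elliptic_at n word_B s" if s: "- 1 \<le> s" "s \<le> x / K" for s
      proof -
        have Ks: "K * s \<le> x" using s(2) K by (simp add: field_simps)
        have "disc_B a b c (K * s) > 0"
        proof (cases "K * s \<le> xA")
          case True
          then show ?thesis using disc_B_pos_before[OF abc F] by (simp add: xA_def)
        next
          case False
          then show ?thesis using e(2)[of "K * s"] Ks x by (simp add: dist_real_def)
        qed
        moreover have "K * s < K * tu" using Ks x by simp
        then have "s < tu" using K by simp
        ultimately show ?thesis using B(1)[OF s(1)] by force
      qed
      moreover have "x / K < tu" using x(3) K by (simp add: field_simps)
      ultimately show "type_A n" unfolding type using x(1) tK[of x] xK
        by (intro exI[of _ "x / K"]) auto
    next
      assume "type_A n"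
      then obtain t where t: "- 1 \<le> t" "t < tu" "xA < K * t"
        and nB: "\<And>s. - 1 \<le> s \<Longrightarrow> s \<le> t \<Longrightarrow> \<not> elliptic_at n word_B s"
        unfolding type by blast
      show "F_poly a b c > 0"
      proof (rule ccontr)
        assume "\<not> F_poly a b c > 0"
        moreover have "\<not> (a = 4 \<and> b = 4 \<and> c = 4)"
        proof
          assume "a = 4 \<and> b = 4 \<and> c = 4"
          then have "r1\<^sup>2 = 1" "r2\<^sup>2 = 1" "r3\<^sup>2 = 1" by (auto simp: a b c)
          then show False using ne(2) pos by (auto simp: power2_eq_1_iff)
        qed
        \<comment> \<open>At this point, before \<open>K * t\<close>, \<open>W_B\<close> is already
          elliptic, against the choice of \<open>t\<close>.\<close>
        ultimately obtain x where x: "xA \<le> x" "x < K * t" "disc_B a b c x < 0"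
          using disc_B_neg_after[OF abc, of "K * t"] t(3) unfolding xA_def by auto
        have xK: "K * (x / K) = x" using K by simp
        have le: "x / K \<le> t" using x(2) K by (simp add: field_simps)
        then have "elliptic_at n word_B (x / K)" using B(2)[of "x / K"] tK[OF x(1)] t(2) x(3) xK by simp
        then show False using nB[OF tK[OF x(1)] le] by blast
      qed
    qed
  qed
qed

end
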